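(* Let $A=K[a_1,\ldots,a_n]$ be a weighted $\mathbb{N}$-graded solvable polynomial algebra with respect to a positive-degree function $d(\ )$, with admissible system $(\mathscr{B},\prec)$, let $L=\oplus_{i=1}^sAe_i$ be an $\mathbb{N}$-graded free left $A$-module with $d_{\rm gr}(e_i)=b_i$, and let $\prec_e$ be a left monomial ordering on $\{a^{\alpha}e_i\}$. Let $U=\{\xi_1,\ldots,\xi_m\}\subset L$ be a finite set of nonzero homogeneous elements with $d_{\rm gr}(\xi_1)\le d_{\rm gr}(\xi_2)\le\cdots\le d_{\rm gr}(\xi_m)$. Then the following algorithm returns a minimal homogeneous generating set $U_{\min}=\{\xi_{j_1},\ldots,\xi_{j_r}\}\subset U$ for the graded submodule $N=\sum_{i=1}^mA\xi_i$; and meanwhile it returns a homogeneous left Gröbner basis $\mathcal{G}=\{g_1,\ldots,g_t\}$ for $N$ such that $d_{\rm gr}(g_1)\le d_{\rm gr}(g_2)\le\cdots\le d_{\rm gr}(g_t)$. Algorithm. Initialize $\mathcal{S}:=\emptyset$, $W:=U$, $\mathcal{G}:=\emptyset$, $t':=0$, $U_{\min}:=\emptyset$. Execute the following loop until $\mathcal{S}=\emptyset$ (the condition being tested at the end of each pass through the loop): Let $\nu:=\min\{d_{\rm gr}(\xi_i),\ d_{\rm gr}(S_{\ell}(g_i,g_j))\mid \xi_i\in W,\ S_{\ell}(g_i,g_j)\in\mathcal{S}\}$. Put $\mathcal{S}_\nu:=\{S_{\ell}(g_i,g_j)\in\mathcal{S}\mid d_{\rm gr}(S_{\ell}(g_i,g_j))=\nu\}$,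 $W_\nu:=\{\xi_j\in W\mid d_{\rm gr}(\xi_j)=\nu\}$, $\mathcal{S}:=\mathcal{S}-\mathcal{S}_\nu$, $W:=W-W_\nu$. (a) While $\mathcal{S}_\nu\ne\emptyset$: choose any $S_{\ell}(g_i,g_j)\in\mathcal{S}_\nu$, remove it from $\mathcal{S}_\nu$, and let $\eta=\overline{S_{\ell}(g_i,g_j)}^{\mathcal{G}}$. If $\eta\ne0$ with $\mathbf{LM}(\eta)=a^{\rho}e_k$, set $t':=t'+1$, $g_{t'}:=\eta$, $\mathcal{S}:=\mathcal{S}\cup\{S_{\ell}(g_i,g_{t'})\mid g_i\in\mathcal{G},\ 1\le i<t',\ \mathbf{LM}(g_i)=a^{\tau}e_k\text{ for some }\tau\}$, $\mathcal{G}:=\mathcal{G}\cup\{g_{t'}\}$. (b) Then, while $W_\nu\ne\emptyset$: choose any $\xi_j\in W_\nu$, remove it from $W_\nu$, and let $\eta=\overline{\xi_j}^{\mathcal{G}}$. If $\eta\ne0$ with $\mathbf{LM}(\eta)=a^{\rho}e_k$, set $U_{\min}:=U_{\min}\cup\{\xi_j\}$, $t':=t'+1$, $g_{t'}:=\eta$, $\mathcal{S}:=\mathcal{S}\cup\{S_{\ell}(g_i,g_{t'})\mid g_i\in\mathcal{G},\ 1\le i<t',\ \mathbf{LM}(g_i)=a^{\tau}e_k\text{ for some }\tau\}$, $\mathcal{G}:=\mathcal{G}\cup\{g_{t'}\}$.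
   Context: $K$ is a field, $K^*=K\setminus\{0\}$, $\mathbb{N}$ is the set of nonnegative integers; algebras are associative unital $K$-algebras; modules are left unitary modules. Solvable polynomial algebra. $A=K[a_1,\ldots,a_n]$ is a $K$-algebra generated by a minimal generating set $\{a_1,\ldots,a_n\}$ (not necessarily commuting) such that $\mathscr{B}=\{a^{\alpha}=a_1^{\alpha_1}\cdots a_n^{\alpha_n}\mid\alpha\in\mathbb{N}^n\}$ is a $K$-basis of $A$; elements of $\mathscr{B}$ are monomials. For a total ordering $\prec$ on $\mathscr{B}$ and $0\ne f\in A$, $\mathbf{LM}(f)$ is the largest monomial occurring in $f$, $\mathbf{LC}(f)$ its coefficient, $\mathbf{LT}(f)=\mathbf{LC}(f)\mathbf{LM}(f)$. $\prec$ is a monomial ordering if: (1) it is a well-ordering; (2) if $a^{\alpha}\prec a^{\beta}$ and $\mathbf{LM}(a^{\gamma}a^{\alpha}a^{\eta}),\mathbf{LM}(a^{\gamma}a^{\beta}a^{\eta})\notin K$ then $\mathbf{LM}(a^{\gamma}a^{\alpha}a^{\eta})\prec\mathbf{LM}(a^{\gamma}a^{\beta}a^{\eta})$; (3) if $a^{\beta}\ne a^{\gamma}$ and $a^{\gamma}=\mathbf{LM}(a^{\alpha}a^{\beta}a^{\eta})$ then $a^{\beta}\prec a^{\gamma}$. Then $(\mathscr{B},\prec)$ is an admissible system. $A$ is a solvable polynomial algebra if moreover for all $\alpha,\beta$: $a^{\alpha}a^{\beta}=\lambda_{\alpha,\beta}a^{\alpha+\beta}+f_{\alpha,\beta}$ with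 $\lambda_{\alpha,\beta}\in K^*$ and $f_{\alpha,\beta}=0$ or $\mathbf{LM}(f_{\alpha,\beta})\prec a^{\alpha+\beta}$. Grading. A positive-degree function $d(\ )$ is given by integers $d(a_i)=m_i>0$, $d(a^{\alpha})=\sum m_i\alpha_i$. Put $A_p=K\text{-span}\{a^{\alpha}\mid d(a^{\alpha})=p\}$; $A$ is weighted $\mathbb{N}$-graded with respect to $d(\ )$ if $A_pA_q\subseteq A_{p+q}$ for all $p,q$. For $L=\oplus_iAe_i$ with arbitrarily chosen $b_i\in\mathbb{N}$, the grading is $L=\oplus_qL_q$, $L_q=K\text{-span}\{a^{\alpha}e_i\mid d(a^{\alpha})+b_i=q\}$, so $d_{\rm gr}(e_i)=b_i$; $d_{\rm gr}$ denotes the degree of a nonzero homogeneous element. A graded submodule is one generated by homogeneous elements. A minimal homogeneous generating set is a homogeneous generating set no proper subset of which generates. Orderings and Gröbner bases in $L$. A left monomial ordering $\prec_e$ is a total ordering on $\{a^{\alpha}e_i\}$ such that (1) $a^{\alpha}e_i\prec_ea^{\beta}e_j$ implies $\mathbf{LM}(a^{\gamma}a^{\alpha}e_i)\prec_e\mathbf{LM}(a^{\gamma}a^{\beta}e_j)$ for all $a^{\gamma}\in\mathscr{B}$; (2) $a^{\alpha}\prec a^{\beta}$ implies $a^{\alpha}e_i\prec_ea^{\beta}e_i$. $\mathbf{LM},\mathbf{LC},\mathbf{LT}$ for elements of $L$ are taken with respect to $\prec_e$. $a^{\alpha}e_i\mid a^{\beta}e_j$ means $i=j$ and $a^{\beta}e_j=\mathbf{LM}(a^{\gamma}a^{\alpha}e_i)$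 for some $a^{\gamma}\in\mathscr{B}$ (equivalently $i=j$ and $\alpha_k\le\beta_k$ for all $k$). Division of $\xi\in L$ by a finite set $P\subset L\setminus\{0\}$: if $\mathbf{LM}(p)\mid\mathbf{LM}(\xi)$ for some $p\in P$, with $\mathbf{LM}(\xi)=\mathbf{LM}(a^{\gamma}p)$, replace $\xi$ by $\xi-\frac{\mathbf{LC}(\xi)}{\mathbf{LC}(a^{\gamma}p)}a^{\gamma}p$; otherwise move $\mathbf{LT}(\xi)$ to the remainder and replace $\xi$ by $\xi-\mathbf{LT}(\xi)$; continue until $0$ is reached. The resulting remainder is denoted $\overline{\xi}^{P}$ (with $\overline{\xi}^{\emptyset}=\xi$). A left Gröbner basis of a submodule $N$ is a finite set $\mathcal{G}\subset N$ of nonzero elements such that for every nonzero $\xi\in N$ there is $g\in\mathcal{G}$ with $\mathbf{LM}(g)\mid\mathbf{LM}(\xi)$; it is homogeneous if it consists of homogeneous elements. For $\mathbf{LM}(\xi_i)=a^{\alpha(i)}e_t$, $\mathbf{LM}(\xi_j)=a^{\alpha(j)}e_t$ and $\gamma$ the componentwise maximum of $\alpha(i),\alpha(j)$, the left S-polynomial is $S_{\ell}(\xi_i,\xi_j)=\frac{1}{\mathbf{LC}(a^{\gamma-\alpha(i)}\xi_i)}a^{\gamma-\alpha(i)}\xi_i-\frac{1}{\mathbf{LC}(a^{\gamma-\alpha(j)}\xi_j)}a^{\gamma-\alpha(j)}\xi_j$; for homogeneous elements its degree is $d_{\rm gr}(S_{\ell}(\xi_i,\xi_j))=d(a^{\g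amma})+b_t$.
   Formalization: The loop is run until both 𝒮=∅ and W=∅, not just 𝒮=∅: with the literal test, U={e_1,e_2} with b_1<b_2 stops after the first pass with e_2 still in W, so U_min does not generate N. *)

theory Defs
  imports "HOL-Analysis.Analysis"
begin

text \<open>
  The field \<open>K\<close> is the type \<open>'k\<close>, the (not necessarily commutative) ring \<open>A\<close> is the type \<open>'a\<close>,
  and \<open>scale\<close> is the action of \<open>K\<close> on \<open>A\<close>.
\<close>

locale assoc_algebra = vector_space scale
  for scale :: "'k::field \<Rightarrow> 'a::ring_1 \<Rightarrow> 'a" +
  assumes scale_mult_left: "scale c x * y = scale c (x * y)"
    and scale_mult_right: "x * scale c y = scale c (x * y)"
begin

definition subalgebra :: "'a set \<Rightarrow> bool" where
  "subalgebra S \<longleftrightarrow> subspace S \<and> 1 \<in> S \<and> (\<forall>x\<in>S. \<forall>y\<in>S. x * y \<in> S)"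

definition generates_algebra :: "'a set \<Rightarrow> bool" where
  "generates_algebra X \<longleftrightarrow> subalgebra hull X = UNIV"

definition minimal_generating_set :: "'a set \<Rightarrow> bool" where
  "minimal_generating_set X \<longleftrightarrow>
     generates_algebra X \<and> (\<forall>Y. Y \<subset> X \<longrightarrow> \<not> generates_algebra Y)"

end

text \<open>
  The generators \<open>a\<^sub>1, \<dots>, a\<^sub>n\<close> are indexed by a finite linearly ordered type, whose order fixes the
  order of the factors in \<open>a\<^sub>1\<^bsup>\<alpha>\<^sub>1\<^esup> \<cdots> a\<^sub>n\<^bsup>\<alpha>\<^sub>n\<^esup>\<close>.
\<close>

type_synonym 'n exponent = "(nat, 'n) vec"

definition gen_monomial :: "('n::{finite,linorder} \<Rightarrow> 'a::monoid_mult) \<Rightarrow> 'n exponent \<Rightarrow> 'a" where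
  "gen_monomial a \<alpha> = prod_list (map (\<lambda>i. a i ^ (\<alpha> $ i)) (sorted_list_of_set UNIV))"

definition strict_total_order :: "('b \<Rightarrow> 'b \<Rightarrow> bool) \<Rightarrow> bool" where
  "strict_total_order r \<longleftrightarrow> irreflp r \<and> transp r \<and> totalp r"

definition greatest_wrt :: "('b \<Rightarrow> 'b \<Rightarrow> bool) \<Rightarrow> 'b set \<Rightarrow> 'b" where
  "greatest_wrt r S = (THE x. x \<in> S \<and> (\<forall>y\<in>S. y \<noteq> x \<longrightarrow> r y x))"

text \<open>
  Injectivity of \<open>\<alpha> \<mapsto> a\<^sup>\<alpha>\<close> is part of the family being a basis.  It lets us identify
  \<open>a\<^sup>\<alpha>\<close> with its exponent vector \<open>\<alpha>\<close>, and \<open>a\<^sup>\<alpha>e\<^sub>i\<close> with the pair \<open>(\<alpha>, i)\<close>; leading monomials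
  and the orderings on monomials are expressed through these exponents.
\<close>

locale monomial_basis_algebra = assoc_algebra scale
  for scale :: "'k::field \<Rightarrow> 'a::ring_1 \<Rightarrow> 'a" +
  fixes a :: "'n::{finite,linorder} \<Rightarrow> 'a"
  assumes minimal_generators: "minimal_generating_set (range a)"
    and monomials_inj: "inj (gen_monomial a)"
    and monomials_independent: "independent (range (gen_monomial a))"
    and monomials_span: "span (range (gen_monomial a)) = UNIV"
begin

abbreviation mono_of :: "'n exponent \<Rightarrow> 'a" where
  "mono_of \<equiv> gen_monomial a"

definition coeff_of :: "'a \<Rightarrow> 'n exponent \<Rightarrow> 'k" where
  "coeff_of f \<alpha> = representation (range mono_of) f (mono_of \<alpha>)"

text \<open>As \<open>LM\<close> is an exponent vector, its value at \<open>f = 0\<close> is meaningless.\<close>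

definition LM :: "('n exponent \<Rightarrow> 'n exponent \<Rightarrow> bool) \<Rightarrow> 'a \<Rightarrow> 'n exponent" where
  "LM r f = greatest_wrt r {\<alpha>. coeff_of f \<alpha> \<noteq> 0}"

text \<open>
  In the second condition, \<open>LM(u) \<notin> K\<close> is rendered by \<open>u \<noteq> 0\<close> (with \<open>LM(0) = 0 \<in> K\<close>) and
  \<open>LM(u) \<noteq> a\<^sup>0\<close>, since \<open>a\<^sup>0 = 1\<close> is the only monomial that lies in \<open>K\<close>.
\<close>

definition monomial_ordering :: "('n exponent \<Rightarrow> 'n exponent \<Rightarrow> bool) \<Rightarrow> bool" where
  "monomial_ordering r \<longleftrightarrow>
     strict_total_order r \<and> wfp r \<and>
     (\<forall>\<alpha> \<beta> \<gamma> \<eta>.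
        let u = mono_of \<gamma> * mono_of \<alpha> * mono_of \<eta>; v = mono_of \<gamma> * mono_of \<beta> * mono_of \<eta> in
        r \<alpha> \<beta> \<and> u \<noteq> 0 \<and> LM r u \<noteq> 0 \<and> v \<noteq> 0 \<and> LM r v \<noteq> 0 \<longrightarrow> r (LM r u) (LM r v)) \<and>
     (\<forall>\<alpha> \<beta> \<gamma> \<eta>.
        let u = mono_of \<alpha> * mono_of \<beta> * mono_of \<eta> in
        \<beta> \<noteq> \<gamma> \<and> u \<noteq> 0 \<and> \<gamma> = LM r u \<longrightarrow> r \<beta> \<gamma>)"

text \<open>
  The free module \<open>L = Ae\<^sub>1 \<oplus> \<dots> \<oplus> Ae\<^sub>s\<close> is the type \<open>'a ^ 's\<close> with left \<open>A\<close>-action \<open>(*s)\<close>;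
  the element \<open>a\<^sup>\<alpha>e\<^sub>i\<close> is \<open>axis i (mono_of \<alpha>)\<close>.
\<close>

definition scaleL :: "'k \<Rightarrow> 'a ^ 's::finite \<Rightarrow> 'a ^ 's" where
  "scaleL c \<xi> = (\<chi> i. scale c (\<xi> $ i))"

definition LMl :: "(('n exponent) \<times> 's \<Rightarrow> ('n exponent) \<times> 's \<Rightarrow> bool) \<Rightarrow>
    'a ^ 's::finite \<Rightarrow> ('n exponent) \<times> 's" where
  "LMl r \<xi> = greatest_wrt r {(\<alpha>, i). coeff_of (\<xi> $ i) \<alpha> \<noteq> 0}"

end

locale weighted_graded_solvable_algebra = monomial_basis_algebra scale a
  for scale :: "'k::field \<Rightarrow> 'a::ring_1 \<Rightarrow> 'a"
    and a :: "'n::{finite,linorder} \<Rightarrow> 'a" +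
  fixes prec :: "'n exponent \<Rightarrow> 'n exponent \<Rightarrow> bool"
    and m :: "'n \<Rightarrow> nat"
  assumes admissible: "monomial_ordering prec"
    and solvable: "\<And>\<alpha> \<beta>. \<exists>c f. c \<noteq> 0 \<and> mono_of \<alpha> * mono_of \<beta> = scale c (mono_of (\<alpha> + \<beta>)) + f \<and>
          (f = 0 \<or> prec (LM prec f) (\<alpha> + \<beta>))"
    and positive_degree: "\<And>i. m i > 0"
    and graded: "\<And>p q x y.
          x \<in> span {mono_of \<alpha> |\<alpha>. (\<Sum>i\<in>UNIV. m i * \<alpha> $ i) = p} \<Longrightarrow>
          y \<in> span {mono_of \<alpha> |\<alpha>. (\<Sum>i\<in>UNIV. m i * \<alpha> $ i) = q} \<Longrightarrow>
          x * y \<in> span {mono_of \<alpha> |\<alpha>. (\<Sum>i\<in>UNIV. m i * \<alpha> $ i) = p + q}"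
begin

definition deg_of :: "'n exponent \<Rightarrow> nat" where
  "deg_of \<alpha> = (\<Sum>i\<in>UNIV. m i * \<alpha> $ i)"

end

definition left_span :: "('a::ring_1 ^ 's::finite) set \<Rightarrow> ('a ^ 's) set" where
  "left_span X = {\<Sum>\<xi>\<in>F. c \<xi> *s \<xi> |F c. finite F \<and> F \<subseteq> X}"

text \<open>
  States of the algorithm.  The list \<open>gs = [g\<^sub>1, \<dots>, g\<^sub>t]\<close> carries \<open>\<G>\<close> together with its enumeration
  (list positions start at \<open>0\<close>).  An S-polynomial \<open>S(g\<^sub>i, g\<^sub>j)\<close> is recorded as the index pair
  \<open>(i, j)\<close>, because its degree is attached to the pair: it makes sense also when \<open>S(g\<^sub>i, g\<^sub>j) = 0\<close>.
  The arguments are \<open>\<S>\<close>, \<open>W\<close>, (inside a pass: \<open>\<S>\<^sub>\<nu>\<close>, \<open>W\<^sub>\<nu>\<close>,) \<open>gs\<close> and \<open>U\<^sub>m\<^sub>i\<^sub>n\<close>.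
\<close>

datatype 'l alg_state =
    Pass_Start "(nat \<times> nat) set" "'l set" "'l list" "'l set"
  | In_Pass "(nat \<times> nat) set" "'l set" "(nat \<times> nat) set" "'l set" "'l list" "'l set"
  | Returned "'l list" "'l set"

locale graded_free_module = weighted_graded_solvable_algebra scale a prec m
  for scale :: "'k::field \<Rightarrow> 'a::ring_1 \<Rightarrow> 'a"
    and a :: "'n::{finite,linorder} \<Rightarrow> 'a"
    and prec :: "'n exponent \<Rightarrow> 'n exponent \<Rightarrow> bool"
    and m :: "'n \<Rightarrow> nat" +
  fixes b :: "'s::finite \<Rightarrow> nat"
    and precL :: "('n exponent) \<times> 's \<Rightarrow> ('n exponent) \<times> 's \<Rightarrow> bool"
  assumes precL_total: "strict_total_order precL"
    and precL_mult: "\<And>\<alpha> \<beta> \<gamma> i j. precL (\<alpha>, i) (\<beta>, j) \<Longrightarrow>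
          precL (LMl precL (axis i (mono_of \<gamma> * mono_of \<alpha>)))
                (LMl precL (axis j (mono_of \<gamma> * mono_of \<beta>)))"
    and precL_compatible: "\<And>\<alpha> \<beta> i. prec \<alpha> \<beta> \<Longrightarrow> precL (\<alpha>, i) (\<beta>, i)"
begin

definition hom_component :: "nat \<Rightarrow> ('a ^ 's) set" where
  "hom_component q = module.span scaleL {axis i (mono_of \<alpha>) |\<alpha> i. deg_of \<alpha> + b i = q}"

definition homogeneous :: "'a ^ 's \<Rightarrow> bool" where
  "homogeneous \<xi> \<longleftrightarrow> (\<exists>q. \<xi> \<in> hom_component q)"

definition deg_gr :: "'a ^ 's \<Rightarrow> nat" where
  "deg_gr \<xi> = (THE q. \<xi> \<in> hom_component q)"

definition minimal_homogeneous_generating_set :: "('a ^ 's) set \<Rightarrow> ('a ^ 's) set \<Rightarrow> bool" where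
  "minimal_homogeneous_generating_set X N \<longleftrightarrow>
     (\<forall>\<xi>\<in>X. homogeneous \<xi>) \<and> left_span X = N \<and> (\<forall>Y. Y \<subset> X \<longrightarrow> left_span Y \<noteq> N)"

definition lead :: "'a ^ 's \<Rightarrow> ('n exponent) \<times> 's" where
  "lead \<xi> = LMl precL \<xi>"

definition LC :: "'a ^ 's \<Rightarrow> 'k" where
  "LC \<xi> = coeff_of (\<xi> $ snd (lead \<xi>)) (fst (lead \<xi>))"

definition LT :: "'a ^ 's \<Rightarrow> 'a ^ 's" where
  "LT \<xi> = scaleL (LC \<xi>) (axis (snd (lead \<xi>)) (mono_of (fst (lead \<xi>))))"

definition mono_dvd :: "('n exponent) \<times> 's \<Rightarrow> ('n exponent) \<times> 's \<Rightarrow> bool" where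
  "mono_dvd u v \<longleftrightarrow> snd u = snd v \<and>
     (\<exists>\<gamma>. v = lead (axis (snd u) (mono_of \<gamma> * mono_of (fst u))))"

text \<open>
  Division by \<open>P\<close> acts on pairs (element still to be divided, remainder so far); which divisor is
  used in a step is left open, so \<open>is_remainder P\<close> is a relation.
\<close>

inductive division_step :: "('a ^ 's) set \<Rightarrow> ('a ^ 's) \<times> ('a ^ 's) \<Rightarrow> ('a ^ 's) \<times> ('a ^ 's) \<Rightarrow> bool"
  for P where
  reduce: "\<xi> \<noteq> 0 \<Longrightarrow> p \<in> P \<Longrightarrow> mono_dvd (lead p) (lead \<xi>) \<Longrightarrow> lead \<xi> = lead (mono_of \<gamma> *s p) \<Longrightarrow>
    division_step P (\<xi>, r)
      (\<xi> - scaleL (LC \<xi> / LC (mono_of \<gamma> *s p)) (mono_of \<gamma> *s p), r)"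
| shift: "\<xi> \<noteq> 0 \<Longrightarrow> (\<forall>p\<in>P. \<not> mono_dvd (lead p) (lead \<xi>)) \<Longrightarrow>
    division_step P (\<xi>, r) (\<xi> - LT \<xi>, r + LT \<xi>)"

definition is_remainder :: "('a ^ 's) set \<Rightarrow> 'a ^ 's \<Rightarrow> 'a ^ 's \<Rightarrow> bool" where
  "is_remainder P \<xi> \<eta> \<longleftrightarrow> (division_step P)\<^sup>*\<^sup>* (\<xi>, 0) (0, \<eta>)"

definition left_groebner_basis :: "('a ^ 's) set \<Rightarrow> ('a ^ 's) set \<Rightarrow> bool" where
  "left_groebner_basis G N \<longleftrightarrow> finite G \<and> G \<subseteq> N \<and> 0 \<notin> G \<and>
     (\<forall>\<xi>\<in>N. \<xi> \<noteq> 0 \<longrightarrow> (\<exists>g\<in>G. mono_dvd (lead g) (lead \<xi>)))"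

definition lcm_exp :: "'a ^ 's \<Rightarrow> 'a ^ 's \<Rightarrow> 'n exponent" where
  "lcm_exp \<xi> \<zeta> = (\<chi> k. max (fst (lead \<xi>) $ k) (fst (lead \<zeta>) $ k))"

text \<open>The S-polynomial and its degree are used only when both leading monomials involve the same \<open>e\<^sub>t\<close>.\<close>

definition S_poly :: "'a ^ 's \<Rightarrow> 'a ^ 's \<Rightarrow> 'a ^ 's" where
  "S_poly \<xi> \<zeta> =
     (let \<gamma> = lcm_exp \<xi> \<zeta>;
          u = mono_of (\<gamma> - fst (lead \<xi>)) *s \<xi>;
          v = mono_of (\<gamma> - fst (lead \<zeta>)) *s \<zeta>
      in scaleL (1 / LC u) u - scaleL (1 / LC v) v)"

definition S_deg :: "'a ^ 's \<Rightarrow> 'a ^ 's \<Rightarrow> nat" where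
  "S_deg \<xi> \<zeta> = deg_of (lcm_exp \<xi> \<zeta>) + b (snd (lead \<xi>))"

definition pair_deg :: "('a ^ 's) list \<Rightarrow> nat \<times> nat \<Rightarrow> nat" where
  "pair_deg gs p = S_deg (gs ! fst p) (gs ! snd p)"

definition new_pairs :: "('a ^ 's) list \<Rightarrow> 'a ^ 's \<Rightarrow> (nat \<times> nat) set" where
  "new_pairs gs \<eta> = {(i, length gs) |i. i < length gs \<and> snd (lead (gs ! i)) = snd (lead \<eta>)}"

text \<open>
  One elementary step of the algorithm; all choices (of an element of \<open>\<S>\<^sub>\<nu>\<close> or \<open>W\<^sub>\<nu>\<close>, and of
  the divisors in the divisions) are left open.  The loop is left once both \<open>\<S>\<close> and \<open>W\<close> are
  empty.  Testing \<open>\<S> = {}\<close> alone would stop too early: for \<open>U = {e\<^sub>1, e\<^sub>2}\<close> with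
  \<open>b\<^sub>1 < b\<^sub>2\<close>, the first pass ends with \<open>\<S> = {}\<close> while \<open>e\<^sub>2\<close> is still in \<open>W\<close>.
\<close>

inductive alg_step :: "('a ^ 's) alg_state \<Rightarrow> ('a ^ 's) alg_state \<Rightarrow> bool" where
  start_pass: "\<nu> = Min (pair_deg gs ` S \<union> deg_gr ` W) \<Longrightarrow>
    S\<nu> = {p \<in> S. pair_deg gs p = \<nu>} \<Longrightarrow> W\<nu> = {\<xi> \<in> W. deg_gr \<xi> = \<nu>} \<Longrightarrow>
    alg_step (Pass_Start S W gs Um) (In_Pass (S - S\<nu>) (W - W\<nu>) S\<nu> W\<nu> gs Um)"
| pair_zero: "(i, j) \<in> S\<nu> \<Longrightarrow> is_remainder (set gs) (S_poly (gs ! i) (gs ! j)) 0 \<Longrightarrow>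
    alg_step (In_Pass S W S\<nu> W\<nu> gs Um) (In_Pass S W (S\<nu> - {(i, j)}) W\<nu> gs Um)"
| pair_new: "(i, j) \<in> S\<nu> \<Longrightarrow> is_remainder (set gs) (S_poly (gs ! i) (gs ! j)) \<eta> \<Longrightarrow> \<eta> \<noteq> 0 \<Longrightarrow>
    alg_step (In_Pass S W S\<nu> W\<nu> gs Um)
      (In_Pass (S \<union> new_pairs gs \<eta>) W (S\<nu> - {(i, j)}) W\<nu> (gs @ [\<eta>]) Um)"
| input_zero: "\<xi> \<in> W\<nu> \<Longrightarrow> is_remainder (set gs) \<xi> 0 \<Longrightarrow>
    alg_step (In_Pass S W {} W\<nu> gs Um) (In_Pass S W {} (W\<nu> - {\<xi>}) gs Um)"
| input_new: "\<xi> \<in> W\<nu> \<Longrightarrow> is_remainder (set gs) \<xi> \<eta> \<Longrightarrow> \<eta> \<noteq> 0 \<Longrightarrow>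
    alg_step (In_Pass S W {} W\<nu> gs Um)
      (In_Pass (S \<union> new_pairs gs \<eta>) W {} (W\<nu> - {\<xi>}) (gs @ [\<eta>]) (insert \<xi> Um))"
| exit_loop: "S = {} \<and> W = {} \<Longrightarrow>
    alg_step (In_Pass S W {} {} gs Um) (Returned gs Um)"
| next_pass: "\<not> (S = {} \<and> W = {}) \<Longrightarrow>
    alg_step (In_Pass S W {} {} gs Um) (Pass_Start S W gs Um)"

definition alg_init :: "('a ^ 's) set \<Rightarrow> ('a ^ 's) alg_state" where
  "alg_init U = Pass_Start {} U [] {}"

text \<open>
  \<open>alg_returns U Q\<close>: from input \<open>U\<close>, no run is infinite, and every run that cannot be continued
  has returned a list \<open>gs\<close> and a set \<open>Um\<close> satisfying \<open>Q\<close>.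
\<close>

definition alg_returns :: "('a ^ 's) set \<Rightarrow> (('a ^ 's) list \<Rightarrow> ('a ^ 's) set \<Rightarrow> bool) \<Rightarrow> bool" where
  "alg_returns U Q \<longleftrightarrow>
     termip alg_step (alg_init U) \<and>
     (\<forall>st. alg_step\<^sup>*\<^sup>* (alg_init U) st \<and> \<not> (\<exists>st'. alg_step st st') \<longrightarrow>
        (\<exists>gs Um. st = Returned gs Um \<and> Q gs Um))"

end

end

theory Submission
  imports Defs
begin

text \<open>
  Inputs and S-polynomials are processed by increasing degree, and a new basis element of degree
  \<open>\<nu>\<close> is not divisible by an old leading monomial, so it only creates S-polynomials of degree
  greater than \<open>\<nu>\<close>.  Hence, when the inputs of degree \<open>\<nu>\<close> are considered, all S-polynomials of
  degree at most \<open>\<nu>\<close> have been reduced, and a degree-truncated form of Buchberger's criterion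
  shows that the remainder of an input vanishes iff the input lies in the submodule generated so far.
  No selected input lies in the span of those selected before it; for homogeneous elements
  selected by increasing degree this already gives minimality, by exchange within one degree.
  Termination is Dickson's lemma for the leading monomials of the basis.
\<close>

section \<open>Orders\<close>

text \<open>A product of two monomials of A is a monomial only up to a nonzero factor and lower
  terms, so combinations over A cannot be regrouped monomial by monomial as in the commutative case.
  The proof works instead with K-spans of the products a^\<gamma> g, filed under their leading
  monomials: each correction term is a combination of products with the same g, filed lower down,
  and so stays inside the span that is being bounded.

  A second obstacle is that the orderings need not respect degrees: a smaller monomial may have a
  larger degree. The induction in Buchberger's criterion therefore descends along monomials while
  every representation is kept inside one homogeneous component. Without this restriction it would
  need S-polynomials of uncontrolled degree, which the algorithm has not yet treated at the moment
  when an input is tested.\<close>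

lemma greatest_wrt_props:
  assumes r: "strict_total_order r" and "finite S" "S \<noteq> {}"
  shows "greatest_wrt r S \<in> S \<and> (\<forall>y\<in>S. y \<noteq> greatest_wrt r S \<longrightarrow> r y (greatest_wrt r S))"
proof -
  have tr: "transp r" and tot: "totalp r" and ir: "irreflp r"
    using r by (auto simp: strict_total_order_def)
  have "\<exists>x. x \<in> S \<and> (\<forall>y\<in>S. y \<noteq> x \<longrightarrow> r y x)"
    using assms(2,3)
  proof (induction S rule: finite_ne_induct)
    case (singleton x)
    then show ?case by auto
  next
    case (insert x F)
    then obtain y where y: "y \<in> F" "\<forall>z\<in>F. z \<noteq> y \<longrightarrow> r z y" by blast
    then have "x \<noteq> y" using insert by auto
    then have "r x y \<or> r y x" using tot by (metis UNIV_I totalp_on_def)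
    then show ?case
      using y tr by (metis insert_iff transpD)
  qed
  moreover have "x = y" if "x \<in> S \<and> (\<forall>y\<in>S. y \<noteq> x \<longrightarrow> r y x)" "y \<in> S \<and> (\<forall>z\<in>S. z \<noteq> y \<longrightarrow> r z y)" for x y
    using that ir tr by (metis irreflpD transpD)
  ultimately have "\<exists>!x. x \<in> S \<and> (\<forall>y\<in>S. y \<noteq> x \<longrightarrow> r y x)" by blast
  then show ?thesis
    unfolding greatest_wrt_def by (rule theI')
qed

lemma greatest_wrt_eqI:
  assumes r: "strict_total_order r" and "x \<in> S" "\<And>y. y \<in> S \<Longrightarrow> y \<noteq> x \<Longrightarrow> r y x"
  shows "greatest_wrt r S = x"
  unfolding greatest_wrt_def
proof (rule the_equality)
  show "x \<in> S \<and> (\<forall>y\<in>S. y \<noteq> x \<longrightarrow> r y x)" using assms by blast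
  show "y = x" if "y \<in> S \<and> (\<forall>z\<in>S. z \<noteq> y \<longrightarrow> r z y)" for y
    using that assms unfolding strict_total_order_def by (metis irreflpD transpD)
qed

section \<open>Dickson's lemma\<close>

lemma nat_seq_mono_subseq:
  fixes h :: "nat \<Rightarrow> nat"
  obtains r :: "nat \<Rightarrow> nat" where "strict_mono r" "mono (h \<circ> r)"
proof -
  obtain f where f: "strict_mono f" "monoseq (\<lambda>n. h (f n))"
    using seq_monosub[of h] by blast
  show thesis
  proof (cases "incseq (\<lambda>n. h (f n))")
    case True
    then show thesis using that[of f] f by (simp add: comp_def)
  next
    case False
    then have dec: "decseq (\<lambda>n. h (f n))" using f by (simp add: monoseq_iff)
    \<comment> \<open>A decreasing sequence of naturals attains its infimum at some N and is
      constant from there on; a constant tail is weakly increasing.\<close>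
    obtain N where N: "\<And>n. h (f N) \<le> h (f n)"
      using Inf_nat_def1[of "range (\<lambda>n. h (f n))"] wellorder_Inf_le1[of _ "range (\<lambda>n. h (f n))"] by force
    have "h (f (N + n)) = h (f N)" for n
      using decseqD[OF dec, of N "N + n"] N[of "N + n"] by simp
    moreover have "strict_mono (\<lambda>n. f (N + n))"
      using f(1) by (simp add: strict_mono_def)
    ultimately show thesis
      using that[of "\<lambda>n. f (N + n)"] by (simp add: comp_def mono_def)
  qed
qed

text \<open>Pigeonhole puts infinitely many terms into one component. Refining the subsequence one
  coordinate at a time makes every coordinate weakly increasing, and then its first two terms form
  the pair.\<close>

lemma dickson:
  fixes f :: "nat \<Rightarrow> 'n::finite exponent \<times> 's::finite"
  shows "\<exists>i j. i < j \<and> snd (f i) = snd (f j) \<and> (\<forall>k. fst (f i) $ k \<le> fst (f j) $ k)"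
proof -
  have "\<exists>s. infinite {i. snd (f i) = s}"
  proof (rule ccontr)
    assume "\<nexists>s. infinite {i. snd (f i) = s}"
    then have "finite (\<Union>s. {i. snd (f i) = s})" by (intro finite_UN_I) auto
    moreover have "(\<Union>s. {i. snd (f i) = s}) = (UNIV :: nat set)" by auto
    ultimately show False by simp
  qed
  then obtain s where s: "infinite {i. snd (f i) = s}" by blast
  define e where "e = enumerate {i. snd (f i) = s}"
  have e: "strict_mono e" "\<And>n. snd (f (e n)) = s"
    using strict_mono_enumerate[OF s] enumerate_in_set[OF s] by (auto simp: e_def)
  have "\<exists>r :: nat \<Rightarrow> nat. strict_mono r \<and> (\<forall>k\<in>K. mono (\<lambda>n. fst (f (e (r n))) $ k))" if "finite K" for K :: "'n set"
    using that
  proof (induction K)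
    case empty
    then show ?case using strict_mono_id[where ?'a = nat] by blast
  next
    case (insert k K)
    then obtain r :: "nat \<Rightarrow> nat" where r: "strict_mono r" "\<And>k. k \<in> K \<Longrightarrow> mono (\<lambda>n. fst (f (e (r n))) $ k)" by blast
    obtain r' :: "nat \<Rightarrow> nat" where r': "strict_mono r'" "mono ((\<lambda>n. fst (f (e (r n))) $ k) \<circ> r')"
      by (rule nat_seq_mono_subseq[of "\<lambda>n. fst (f (e (r n))) $ k"])
    have "mono (\<lambda>n. fst (f (e (r (r' n)))) $ j)" if "j \<in> insert k K" for j
    proof (cases "j = k")
      case True
      then show ?thesis using r'(2) by (simp add: comp_def)
    next
      case False
      then show ?thesis
        using r(2)[of j] that strict_mono_mono[OF r'(1)] by (simp add: mono_def)
    qed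
    moreover have "strict_mono (\<lambda>n. r (r' n))"
      using r(1) r'(1) by (simp add: strict_mono_def)
    ultimately show ?case by blast
  qed
  then obtain r :: "nat \<Rightarrow> nat" where r: "strict_mono r" "\<And>k. mono (\<lambda>n. fst (f (e (r n))) $ k)"
    using finite_class.finite_UNIV by blast
  have "e (r 0) < e (r 1)"
    using e(1) r(1) by (simp add: strict_mono_def)
  moreover have "fst (f (e (r 0))) $ k \<le> fst (f (e (r 1))) $ k" for k
    using r(2)[of k] by (simp add: mono_def)
  ultimately show ?thesis using e(2) by metis
qed

text \<open>An infinite chain would append a sequence that has no good pair.\<close>

lemma wf_append_bad:
  assumes good: "\<And>f :: nat \<Rightarrow> 'x. \<exists>i j. i < j \<and> P (f i) (f j)"
  shows "wf {(xs @ [x], xs) |xs x. \<forall>y\<in>set xs. \<not> P y x}"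
  unfolding wf_iff_no_infinite_down_chain
proof
  assume "\<exists>F. \<forall>i. (F (Suc i), F i) \<in> {(xs @ [x], xs) |xs x. \<forall>y\<in>set xs. \<not> P y x}"
  then obtain F where "\<forall>i. \<exists>x. F (Suc i) = F i @ [x] \<and> (\<forall>y\<in>set (F i). \<not> P y x)" by blast
  then obtain h where h: "\<And>i. F (Suc i) = F i @ [h i]" "\<And>i y. y \<in> set (F i) \<Longrightarrow> \<not> P y (h i)"
    by metis
  have "F n = F 0 @ map h [0..<n]" for n
    by (induction n) (simp_all add: h(1))
  then have "h i \<in> set (F j)" if "i < j" for i j
    using that by (metis UnCI atLeastLessThan_iff image_eqI le0 set_append set_map set_upt)
  then show False using good[of h] h(2) by blast
qed

section \<open>Coefficients and supports\<close>

context monomial_basis_algebra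
begin

lemma in_span_monomials: "x \<in> span (range mono_of)"
  by (simp add: monomials_span)

lemma coeff_of_add: "coeff_of (f + g) \<alpha> = coeff_of f \<alpha> + coeff_of g \<alpha>"
  and coeff_of_diff: "coeff_of (f - g) \<alpha> = coeff_of f \<alpha> - coeff_of g \<alpha>"
  and coeff_of_scale: "coeff_of (scale c f) \<alpha> = c * coeff_of f \<alpha>"
  by (simp_all add: coeff_of_def representation_add representation_diff representation_scale
      monomials_independent monomials_span)

lemma coeff_of_zero [simp]: "coeff_of 0 \<alpha> = 0"
  by (simp add: coeff_of_def representation_zero)

lemma coeff_of_mono: "coeff_of (mono_of \<beta>) \<alpha> = (if \<alpha> = \<beta> then 1 else 0)"
  unfolding coeff_of_def
  using monomials_inj by (subst representation_basis[OF monomials_independent]) (auto dest: injD)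

lemma finite_coeff: "finite {\<alpha>. coeff_of f \<alpha> \<noteq> 0}"
proof -
  have "finite (mono_of -` {v. representation (range mono_of) f v \<noteq> 0})"
    by (rule finite_vimageI[OF finite_representation monomials_inj])
  then show ?thesis by (simp add: coeff_of_def vimage_def)
qed

lemma coeff_of_expand: "f = (\<Sum>\<alpha> | coeff_of f \<alpha> \<noteq> 0. scale (coeff_of f \<alpha>) (mono_of \<alpha>))"
proof -
  have "{v. representation (range mono_of) f v \<noteq> 0} = mono_of ` {\<alpha>. coeff_of f \<alpha> \<noteq> 0}"
    using representation_ne_zero[of "range mono_of" f] by (auto simp: coeff_of_def)
  moreover have "inj_on mono_of {\<alpha>. coeff_of f \<alpha> \<noteq> 0}"
    using monomials_inj by (meson inj_on_subset subset_UNIV)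
  ultimately have "(\<Sum>v | representation (range mono_of) f v \<noteq> 0. scale (representation (range mono_of) f v) v) =
      (\<Sum>\<alpha> | coeff_of f \<alpha> \<noteq> 0. scale (coeff_of f \<alpha>) (mono_of \<alpha>))"
    by (simp add: sum.reindex coeff_of_def)
  then show ?thesis
    using sum_nonzero_representation_eq[OF monomials_independent in_span_monomials] by metis
qed

lemma coeff_of_eqI:
  assumes "\<And>\<alpha>. coeff_of f \<alpha> = coeff_of g \<alpha>"
  shows "f = g"
  using coeff_of_expand[of f] coeff_of_expand[of g] assms by simp

lemma in_span_monomials_iff: "f \<in> span (mono_of ` D) \<longleftrightarrow> (\<forall>\<alpha>. coeff_of f \<alpha> \<noteq> 0 \<longrightarrow> \<alpha> \<in> D)"
proof
  show "\<forall>\<alpha>. coeff_of f \<alpha> \<noteq> 0 \<longrightarrow> \<alpha> \<in> D" if "f \<in> span (mono_of ` D)"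
    using that
  proof (induction rule: span_induct_alt)
    case base
    then show ?case by simp
  next
    case (step c x y)
    then show ?case by (auto simp: coeff_of_add coeff_of_scale coeff_of_mono split: if_splits)
  qed
next
  assume "\<forall>\<alpha>. coeff_of f \<alpha> \<noteq> 0 \<longrightarrow> \<alpha> \<in> D"
  then show "f \<in> span (mono_of ` D)"
    by (subst coeff_of_expand) (auto intro!: span_sum span_scale intro: span_base)
qed

section \<open>Coefficients and supports in the free module\<close>

definition cf :: "'a ^ 's \<Rightarrow> ('n exponent) \<times> 's \<Rightarrow> 'k" where
  "cf \<xi> t = coeff_of (\<xi> $ snd t) (fst t)"

definition basis_vec :: "('n exponent) \<times> 's \<Rightarrow> 'a ^ 's" where
  "basis_vec t = axis (snd t) (mono_of (fst t))"

text \<open>Supports in a lower set express bounds on leading monomials; supports in a degree class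
  are the homogeneous components. One predicate for both lets the division argument be carried out
  once, for an arbitrary set.\<close>

definition supported :: "(('n exponent) \<times> 's) set \<Rightarrow> ('a ^ 's) set" where
  "supported D = {\<xi>. \<forall>t. cf \<xi> t \<noteq> 0 \<longrightarrow> t \<in> D}"

lemma supportedD: "\<xi> \<in> supported D \<Longrightarrow> cf \<xi> t \<noteq> 0 \<Longrightarrow> t \<in> D"
  unfolding supported_def by blast

sublocale L: vector_space "scaleL :: 'k \<Rightarrow> 'a ^ 's::finite \<Rightarrow> 'a ^ 's"
  by unfold_locales (simp_all add: scaleL_def vec_eq_iff scale_right_distrib scale_left_distrib)

lemma cf_add: "cf (\<xi> + \<zeta>) t = cf \<xi> t + cf \<zeta> t"
  and cf_diff: "cf (\<xi> - \<zeta>) t = cf \<xi> t - cf \<zeta> t"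
  and cf_scaleL: "cf (scaleL c \<xi>) t = c * cf \<xi> t"
  and cf_zero [simp]: "cf 0 t = 0"
  by (simp_all add: cf_def coeff_of_add coeff_of_diff coeff_of_scale scaleL_def)

lemma cf_basis_vec: "cf (basis_vec t) s = (if s = t then 1 else 0)"
  by (auto simp: cf_def basis_vec_def axis_def coeff_of_mono prod_eq_iff)

lemma cf_eqI: "(\<And>t. cf \<xi> t = cf \<zeta> t) \<Longrightarrow> \<xi> = \<zeta>"
  unfolding cf_def vec_eq_iff by (metis coeff_of_eqI fst_conv snd_conv)

lemma finite_cf: "finite {t. cf \<xi> t \<noteq> 0}"
proof -
  have "{t. cf \<xi> t \<noteq> 0} \<subseteq> (\<Union>i. (\<lambda>\<alpha>. (\<alpha>, i)) ` {\<alpha>. coeff_of (\<xi> $ i) \<alpha> \<noteq> 0})"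
    by (auto simp: cf_def image_iff)
  then show ?thesis
    by (rule finite_subset) (auto simp: finite_coeff)
qed

lemma cf_sum: "cf (sum f I) t = (\<Sum>i\<in>I. cf (f i) t)"
  by (induction I rule: infinite_finite_induct) (simp_all add: cf_add)

lemma cf_expand: "\<xi> = (\<Sum>t | cf \<xi> t \<noteq> 0. scaleL (cf \<xi> t) (basis_vec t))"
proof (rule cf_eqI)
  fix s
  have "cf (\<Sum>t | cf \<xi> t \<noteq> 0. scaleL (cf \<xi> t) (basis_vec t)) s =
      (\<Sum>t | cf \<xi> t \<noteq> 0. if t = s then cf \<xi> s else 0)"
    unfolding cf_sum by (rule sum.cong) (auto simp: cf_scaleL cf_basis_vec)
  also have "\<dots> = cf \<xi> s" by (simp add: finite_cf)
  finally show "cf \<xi> s = cf (\<Sum>t | cf \<xi> t \<noteq> 0. scaleL (cf \<xi> t) (basis_vec t)) s" by simp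
qed

lemma subspace_supported: "L.subspace (supported D)"
  by (rule L.subspaceI) (auto simp: supported_def cf_add cf_scaleL, metis add.right_neutral)

lemma supported_eq_span: "supported D = L.span (basis_vec ` D)"
proof
  show "L.span (basis_vec ` D) \<subseteq> supported D"
    by (rule L.span_minimal[OF _ subspace_supported])
      (auto simp: supported_def cf_basis_vec split: if_splits)
  show "supported D \<subseteq> L.span (basis_vec ` D)"
  proof
    fix \<xi> assume "\<xi> \<in> supported D"
    then show "\<xi> \<in> L.span (basis_vec ` D)"
      by (subst cf_expand) (auto intro!: L.span_sum L.span_scale intro: L.span_base dest: supportedD)
  qed
qed

text \<open>The cancellation common to division steps, S-polynomials and the splitting off of a
  leading term: matching coefficients at t remove t from the support.\<close>

lemma supported_cancel_term:
  assumes "\<xi> \<in> supported (insert t D)" "\<zeta> \<in> supported (insert t D)" "cf \<xi> t = c * cf \<zeta> t"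
  shows "\<xi> - scaleL c \<zeta> \<in> supported D"
  unfolding supported_def
proof (intro CollectI allI impI)
  fix s assume s: "cf (\<xi> - scaleL c \<zeta>) s \<noteq> 0"
  then have "s \<noteq> t" using assms(3) by (auto simp: cf_diff cf_scaleL)
  moreover have "cf \<xi> s \<noteq> 0 \<or> cf \<zeta> s \<noteq> 0" using s by (auto simp: cf_diff cf_scaleL)
  ultimately show "s \<in> D" using assms(1,2) by (auto dest: supportedD)
qed

lemma module_hom_left_smult: "module_hom scaleL scaleL (\<lambda>\<xi> :: 'a ^ 's::finite. x *s \<xi>)"
  by unfold_locales (simp_all add: vector_add_ldistrib scaleL_def vec_eq_iff scale_mult_right)

lemma module_hom_right_smult: "module_hom scale scaleL (\<lambda>x. x *s (\<xi> :: 'a ^ 's::finite))"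
  by unfold_locales (simp_all add: vector_sadd_rdistrib scaleL_def vec_eq_iff scale_mult_left)

lemma module_hom_axis: "module_hom scale scaleL (axis i :: 'a \<Rightarrow> 'a ^ 's::finite)"
  by unfold_locales (simp_all add: scaleL_def vec_eq_iff axis_def)

lemma span_smult:
  fixes X :: "('a ^ 's::finite) set"
  assumes "\<And>\<xi>. \<xi> \<in> X \<Longrightarrow> x *s \<xi> \<in> L.span Y" "\<zeta> \<in> L.span X"
  shows "x *s \<zeta> \<in> L.span Y"
proof -
  have "(*s) x ` L.span X = L.span ((*s) x ` X)"
    by (rule module_hom.span_image[symmetric, OF module_hom_left_smult])
  also have "\<dots> \<subseteq> L.span Y"
    by (rule L.span_minimal) (use assms(1) in auto)
  finally show ?thesis using assms(2) by blast
qed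

end

section \<open>Leading monomials of products\<close>

context weighted_graded_solvable_algebra
begin

lemma prec_total: "strict_total_order prec"
  and prec_wf: "wfp prec"
  using admissible by (auto simp: monomial_ordering_def)

lemma prec_trans: "prec \<alpha> \<beta> \<Longrightarrow> prec \<beta> \<gamma> \<Longrightarrow> prec \<alpha> \<gamma>"
  using prec_total unfolding strict_total_order_def by (meson transpD)

lemma coeff_of_le_LM:
  assumes "coeff_of f \<alpha> \<noteq> 0"
  shows "\<alpha> = LM prec f \<or> prec \<alpha> (LM prec f)"
  using greatest_wrt_props[OF prec_total finite_coeff, of f] assms by (auto simp: LM_def)

text \<open>Bounding the tail by a span instead of by its leading monomial absorbs the case of a
  zero tail and is compatible with linear maps.\<close>

lemma mono_mult:
  obtains c f where "c \<noteq> 0" "mono_of \<alpha> * mono_of \<beta> = scale c (mono_of (\<alpha> + \<beta>)) + f"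
    "f \<in> span (mono_of ` {\<delta>. prec \<delta> (\<alpha> + \<beta>)})"
proof -
  obtain c f where cf: "c \<noteq> 0" "mono_of \<alpha> * mono_of \<beta> = scale c (mono_of (\<alpha> + \<beta>)) + f"
    "f = 0 \<or> prec (LM prec f) (\<alpha> + \<beta>)"
    using solvable by blast
  have "f \<in> span (mono_of ` {\<delta>. prec \<delta> (\<alpha> + \<beta>)})"
    unfolding in_span_monomials_iff using cf(3) coeff_of_le_LM prec_trans
    by (metis coeff_of_zero mem_Collect_eq)
  then show thesis using that cf by blast
qed

lemma mono_mult_degree:
  "mono_of \<alpha> * mono_of \<beta> \<in> span (mono_of ` {\<delta>. deg_of \<delta> = deg_of \<alpha> + deg_of \<beta>})"
proof -
  have "{mono_of \<delta> |\<delta>. (\<Sum>i\<in>UNIV. m i * \<delta> $ i) = p} = mono_of ` {\<delta>. deg_of \<delta> = p}" for p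
    by (auto simp: deg_of_def)
  then show ?thesis
    using graded[of "mono_of \<alpha>" "deg_of \<alpha>" "mono_of \<beta>" "deg_of \<beta>"] by (simp add: span_base)
qed

lemma deg_of_add: "deg_of (\<alpha> + \<beta>) = deg_of \<alpha> + deg_of \<beta>"
  by (simp add: deg_of_def distrib_left sum.distrib)

text \<open>Positivity of the weights enters here. It makes degrees rise strictly under
  multiplication by a nontrivial monomial, on which both the degrees of new pairs and the exchange
  argument rest.\<close>

lemma deg_of_eq_0_iff: "deg_of \<alpha> = 0 \<longleftrightarrow> \<alpha> = 0"
proof -
  have "m i \<noteq> 0" for i using positive_degree[of i] by simp
  then show ?thesis by (simp add: deg_of_def vec_eq_iff del: neq0_conv)
qed

end

context graded_free_module
begin

text \<open>By \<open>lead_smult\<close> this is the effect of multiplication by a^\<gamma> on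
  leading monomials, although the product itself has further, lower terms.\<close>

definition shift :: "'n exponent \<Rightarrow> ('n exponent) \<times> 's \<Rightarrow> ('n exponent) \<times> 's" where
  "shift \<gamma> t = (\<gamma> + fst t, snd t)"

definition wt :: "('n exponent) \<times> 's \<Rightarrow> nat" where
  "wt t = deg_of (fst t) + b (snd t)"

abbreviation below :: "('n exponent) \<times> 's \<Rightarrow> (('n exponent) \<times> 's) set" where
  "below t \<equiv> {s. precL s t}"

lemma wt_shift: "wt (shift \<gamma> t) = deg_of \<gamma> + wt t"
  by (simp add: wt_def shift_def deg_of_add)

lemma shift_shift: "shift \<gamma> (shift \<delta> t) = shift (\<gamma> + \<delta>) t"
  by (simp add: shift_def add.assoc)

lemma precL_trans: "precL s t \<Longrightarrow> precL t u \<Longrightarrow> precL s u"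
  using precL_total unfolding strict_total_order_def by (meson transpD)

lemma precL_irrefl: "\<not> precL t t"
  using precL_total unfolding strict_total_order_def by (meson irreflpD)

lemma precL_linear: "precL s t \<or> s = t \<or> precL t s"
  using precL_total unfolding strict_total_order_def by (metis UNIV_I totalp_on_def)

text \<open>Only \<open>prec\<close> is well-founded by assumption. Within one component
  \<open>precL\<close> extends \<open>prec\<close>, and there are finitely many components: take the
  least exponent in each component that occurs, then the least of these finitely many
  monomials.\<close>

lemma precL_wf: "wfp precL"
  unfolding wfp_iff_ex_minimal
proof (intro allI impI)
  fix Q :: "(('n exponent) \<times> 's) set" assume "Q \<noteq> {}"
  have ex: "\<exists>\<alpha>. (\<alpha>, i) \<in> Q \<and> (\<forall>\<beta>. prec \<beta> \<alpha> \<longrightarrow> (\<beta>, i) \<notin> Q)" if "(\<beta>, i) \<in> Q" for \<beta> i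
    using prec_wf[unfolded wfp_iff_ex_minimal, rule_format, of "{\<alpha>. (\<alpha>, i) \<in> Q}"] that by auto
  then obtain h where h: "\<And>\<beta> i. (\<beta>, i) \<in> Q \<Longrightarrow> (h i, i) \<in> Q"
    "\<And>\<beta> \<gamma> i. (\<beta>, i) \<in> Q \<Longrightarrow> prec \<gamma> (h i) \<Longrightarrow> (\<gamma>, i) \<notin> Q"
    using that[of "\<lambda>i. SOME \<alpha>. (\<alpha>, i) \<in> Q \<and> (\<forall>\<beta>. prec \<beta> \<alpha> \<longrightarrow> (\<beta>, i) \<notin> Q)"]
      someI_ex[OF ex] by blast
  define M where "M = (\<lambda>i. (h i, i)) ` snd ` Q"
  \<comment> \<open>The greatest element for the reversed order is the least one for
    \<open>precL\<close>.\<close>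
  have "strict_total_order (\<lambda>x y. precL y x)"
    unfolding strict_total_order_def irreflp_def transp_def totalp_on_def
    using precL_irrefl precL_trans precL_linear by blast
  moreover have "finite M" "M \<noteq> {}" using \<open>Q \<noteq> {}\<close> by (auto simp: M_def)
  ultimately obtain t where t: "t \<in> M" "\<And>y. y \<in> M \<Longrightarrow> y \<noteq> t \<Longrightarrow> precL t y"
    using greatest_wrt_props by blast
  have "t \<in> Q" using t(1) h(1) by (auto simp: M_def)
  moreover have "y \<notin> Q" if "precL y t" for y
  proof
    assume y: "y \<in> Q"
    obtain \<beta> i where bi: "y = (\<beta>, i)" by force
    have "\<not> prec \<beta> (h i)" using h(2) y bi by blast
    then have "\<beta> = h i \<or> prec (h i) \<beta>"
      using prec_total unfolding strict_total_order_def by (metis UNIV_I totalp_on_def)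
    then have 1: "y = (h i, i) \<or> precL (h i, i) y" using precL_compatible bi by auto
    have "(h i, i) \<in> M" using y bi by (force simp: M_def)
    then have "(h i, i) = t \<or> precL t (h i, i)" using t(2) by blast
    then show False using 1 that precL_trans precL_irrefl by metis
  qed
  ultimately show "\<exists>z\<in>Q. \<forall>y. precL y z \<longrightarrow> y \<notin> Q" by blast
qed

lemma lead_props:
  assumes "\<xi> \<noteq> 0"
  shows "cf \<xi> (lead \<xi>) \<noteq> 0" "\<xi> \<in> supported (insert (lead \<xi>) (below (lead \<xi>)))"
proof -
  have "{t. cf \<xi> t \<noteq> 0} \<noteq> {}" using assms cf_eqI[of \<xi> 0] by auto
  moreover have "lead \<xi> = greatest_wrt precL {t. cf \<xi> t \<noteq> 0}"
    by (simp add: lead_def LMl_def cf_def case_prod_unfold)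
  ultimately have "lead \<xi> \<in> {t. cf \<xi> t \<noteq> 0} \<and> (\<forall>y\<in>{t. cf \<xi> t \<noteq> 0}. y \<noteq> lead \<xi> \<longrightarrow> precL y (lead \<xi>))"
    using greatest_wrt_props[OF precL_total finite_cf] by metis
  then show "cf \<xi> (lead \<xi>) \<noteq> 0" "\<xi> \<in> supported (insert (lead \<xi>) (below (lead \<xi>)))"
    by (auto simp: supported_def)
qed

lemma lead_eqI:
  assumes "cf \<xi> t \<noteq> 0" "\<xi> \<in> supported (insert t (below t))"
  shows "lead \<xi> = t"
proof -
  have "lead \<xi> = greatest_wrt precL {t. cf \<xi> t \<noteq> 0}"
    by (simp add: lead_def LMl_def cf_def case_prod_unfold)
  also have "\<dots> = t"
    using assms by (intro greatest_wrt_eqI[OF precL_total]) (auto dest: supportedD)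
  finally show ?thesis .
qed

lemma LC_eq: "LC \<xi> = cf \<xi> (lead \<xi>)"
  by (simp add: LC_def cf_def)

lemma LC_nonzero: "\<xi> \<noteq> 0 \<Longrightarrow> LC \<xi> \<noteq> 0"
  by (simp add: LC_eq lead_props)

lemma LT_eq: "LT \<xi> = scaleL (LC \<xi>) (basis_vec (lead \<xi>))"
  by (simp add: LT_def basis_vec_def)

lemma lead_in: "\<xi> \<noteq> 0 \<Longrightarrow> \<xi> \<in> supported D \<Longrightarrow> lead \<xi> \<in> D"
  using lead_props(1) supportedD by blast

lemma lead_le: "cf \<xi> t \<noteq> 0 \<Longrightarrow> t = lead \<xi> \<or> precL t (lead \<xi>)"
  using lead_props(2)[of \<xi>] by (metis cf_zero insertE mem_Collect_eq supportedD)

text \<open>The tail of the product lives in the same component, where compatibility of the two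
  orderings turns terms lower for \<open>prec\<close> into terms lower for
  \<open>precL\<close>.\<close>

lemma smult_basis_vec:
  obtains c \<zeta> where "c \<noteq> 0" "mono_of \<gamma> *s basis_vec t = scaleL c (basis_vec (shift \<gamma> t)) + \<zeta>"
    "\<zeta> \<in> supported (below (shift \<gamma> t))"
proof -
  obtain c f where cf: "c \<noteq> 0" "mono_of \<gamma> * mono_of (fst t) = scale c (mono_of (\<gamma> + fst t)) + f"
    "f \<in> span (mono_of ` {\<delta>. prec \<delta> (\<gamma> + fst t)})"
    by (rule mono_mult)
  have "mono_of \<gamma> *s basis_vec t = axis (snd t) (mono_of \<gamma> * mono_of (fst t))"
    by (simp add: basis_vec_def vec_eq_iff axis_def)
  also have "\<dots> = scaleL c (basis_vec (shift \<gamma> t)) + axis (snd t) f"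
    by (simp add: cf(2) basis_vec_def shift_def vec_eq_iff axis_def scaleL_def)
  finally have "mono_of \<gamma> *s basis_vec t = scaleL c (basis_vec (shift \<gamma> t)) + axis (snd t) f" .
  moreover have "axis (snd t) f \<in> supported (below (shift \<gamma> t))"
  proof -
    have "axis (snd t) f \<in> axis (snd t) ` span (mono_of ` {\<delta>. prec \<delta> (\<gamma> + fst t)})"
      using cf(3) by blast
    also have "\<dots> = L.span (axis (snd t) ` mono_of ` {\<delta>. prec \<delta> (\<gamma> + fst t)})"
      by (rule module_hom.span_image[symmetric, OF module_hom_axis])
    also have "\<dots> \<subseteq> supported (below (shift \<gamma> t))"
      unfolding supported_eq_span
    proof (rule L.span_mono, clarify)
      fix \<delta> assume "prec \<delta> (\<gamma> + fst t)"
      then have "precL (\<delta>, snd t) (shift \<gamma> t)" by (simp add: shift_def precL_compatible)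
      then show "axis (snd t) (mono_of \<delta>) \<in> basis_vec ` below (shift \<gamma> t)"
        by (intro image_eqI[of _ _ "(\<delta>, snd t)"]) (auto simp: basis_vec_def)
    qed
    finally show ?thesis .
  qed
  ultimately show thesis using that cf(1) by blast
qed

lemma lead_smult_basis_vec: "lead (mono_of \<gamma> *s basis_vec t) = shift \<gamma> t"
proof -
  obtain c \<zeta> where c: "c \<noteq> 0" "mono_of \<gamma> *s basis_vec t = scaleL c (basis_vec (shift \<gamma> t)) + \<zeta>"
    "\<zeta> \<in> supported (below (shift \<gamma> t))"
    by (rule smult_basis_vec)
  have "cf \<zeta> (shift \<gamma> t) = 0" using c(3) precL_irrefl supportedD by blast
  then show ?thesis
    using c by (intro lead_eqI)
      (auto simp: cf_add cf_scaleL cf_basis_vec supported_def split: if_splits)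
qed

lemma axis_mono_mult: "axis i (mono_of \<gamma> * mono_of \<alpha>) = mono_of \<gamma> *s basis_vec (\<alpha>, i)"
  by (simp add: basis_vec_def vec_eq_iff axis_def)

text \<open>The ordering axiom speaks of leading monomials of products. Since these are obtained by
  adding exponents, the axiom amounts to translation invariance.\<close>

lemma precL_shift:
  assumes "precL s t" shows "precL (shift \<gamma> s) (shift \<gamma> t)"
proof -
  have "precL (LMl precL (axis (snd s) (mono_of \<gamma> * mono_of (fst s))))
      (LMl precL (axis (snd t) (mono_of \<gamma> * mono_of (fst t))))"
    by (rule precL_mult) (use assms in simp)
  then show ?thesis
    unfolding axis_mono_mult lead_def[symmetric] lead_smult_basis_vec by simp
qed

lemma smult_supported_below:
  assumes "\<xi> \<in> supported (below t)"
  shows "mono_of \<gamma> *s \<xi> \<in> supported (below (shift \<gamma> t))"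
  using assms unfolding supported_eq_span
proof (rule span_smult[rotated], unfold supported_eq_span[symmetric])
  fix \<zeta> assume "\<zeta> \<in> basis_vec ` below t"
  then obtain s where s: "precL s t" "\<zeta> = basis_vec s" by blast
  obtain c \<eta> where "mono_of \<gamma> *s basis_vec s = scaleL c (basis_vec (shift \<gamma> s)) + \<eta>"
    "\<eta> \<in> supported (below (shift \<gamma> s))"
    by (rule smult_basis_vec)
  then show "mono_of \<gamma> *s \<zeta> \<in> supported (below (shift \<gamma> t))"
    using s(2) precL_shift[OF s(1), of \<gamma>]
    by (auto simp: supported_def cf_add cf_scaleL cf_basis_vec split: if_splits intro: precL_trans)
qed

text \<open>At the shifted monomial only the leading term contributes, with the nonzero coefficient
  \<open>cf \<xi> t * c\<close>; the tail of the monomial product and the multiple of the remaining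
  terms of \<xi> both stay strictly below.\<close>

lemma lead_smult:
  assumes "\<xi> \<noteq> 0"
  shows "lead (mono_of \<gamma> *s \<xi>) = shift \<gamma> (lead \<xi>)" "mono_of \<gamma> *s \<xi> \<noteq> 0"
proof -
  define t where "t = lead \<xi>"
  define \<zeta> where "\<zeta> = \<xi> - scaleL (cf \<xi> t) (basis_vec t)"
  have c0: "cf \<xi> t \<noteq> 0" using assms by (simp add: t_def lead_props)
  have "\<zeta> \<in> supported (below t)"
    unfolding \<zeta>_def by (rule supported_cancel_term)
      (use lead_props(2)[OF assms] in \<open>auto simp: t_def supported_def cf_basis_vec split: if_splits\<close>)
  then have z: "mono_of \<gamma> *s \<zeta> \<in> supported (below (shift \<gamma> t))"
    by (rule smult_supported_below)
  obtain c \<eta> where c: "c \<noteq> 0" "mono_of \<gamma> *s basis_vec t = scaleL c (basis_vec (shift \<gamma> t)) + \<eta>"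
    "\<eta> \<in> supported (below (shift \<gamma> t))"
    by (rule smult_basis_vec)
  interpret h: module_hom scaleL scaleL "\<lambda>\<xi> :: 'a ^ 's. mono_of \<gamma> *s \<xi>"
    by (rule module_hom_left_smult)
  have eq: "mono_of \<gamma> *s \<xi> = scaleL (cf \<xi> t * c) (basis_vec (shift \<gamma> t)) +
      (scaleL (cf \<xi> t) \<eta> + mono_of \<gamma> *s \<zeta>)"
    by (simp add: \<zeta>_def h.diff h.scale c(2) L.scale_right_distrib)
  have low: "scaleL (cf \<xi> t) \<eta> + mono_of \<gamma> *s \<zeta> \<in> supported (below (shift \<gamma> t))"
    using L.subspace_add[OF subspace_supported] L.subspace_scale[OF subspace_supported] c(3) z by blast
  then have "cf (scaleL (cf \<xi> t) \<eta> + mono_of \<gamma> *s \<zeta>) (shift \<gamma> t) = 0"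
    using precL_irrefl supportedD by blast
  then have nz: "cf (mono_of \<gamma> *s \<xi>) (shift \<gamma> t) \<noteq> 0"
    using c0 c(1) unfolding eq by (simp add: cf_add cf_scaleL cf_basis_vec)
  then show "mono_of \<gamma> *s \<xi> \<noteq> 0" by auto
  have "mono_of \<gamma> *s \<xi> \<in> supported (insert (shift \<gamma> t) (below (shift \<gamma> t)))"
    unfolding eq using low by (auto simp: supported_def cf_add cf_scaleL cf_basis_vec split: if_splits)
  then show "lead (mono_of \<gamma> *s \<xi>) = shift \<gamma> (lead \<xi>)"
    using lead_eqI nz by (simp add: t_def)
qed

lemma mono_dvd_iff_shift: "mono_dvd u v \<longleftrightarrow> (\<exists>\<gamma>. v = shift \<gamma> u)"
  by (auto simp: mono_dvd_def axis_mono_mult lead_smult_basis_vec shift_def)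

text \<open>The form of divisibility to which Dickson's lemma applies.\<close>

lemma mono_dvd_iff_le: "mono_dvd u v \<longleftrightarrow> snd u = snd v \<and> (\<forall>k. fst u $ k \<le> fst v $ k)"
proof
  assume "snd u = snd v \<and> (\<forall>k. fst u $ k \<le> fst v $ k)"
  then have "v = shift (fst v - fst u) u"
    by (auto simp: shift_def prod_eq_iff vec_eq_iff)
  then show "mono_dvd u v" unfolding mono_dvd_iff_shift by blast
qed (auto simp: mono_dvd_iff_shift shift_def)

section \<open>The grading of the free module\<close>

lemma hom_component_eq: "hom_component q = supported {t. wt t = q}"
proof -
  have "{axis i (mono_of \<alpha>) |\<alpha> i. deg_of \<alpha> + b i = q} = basis_vec ` {t. wt t = q}"
    by (force simp: basis_vec_def wt_def image_iff)
  then show ?thesis by (simp add: hom_component_def supported_eq_span)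
qed

lemma smult_hom_component:
  assumes "\<xi> \<in> hom_component q"
  shows "mono_of \<gamma> *s \<xi> \<in> hom_component (deg_of \<gamma> + q)"
  using assms unfolding hom_component_eq supported_eq_span
proof (rule span_smult[rotated])
  fix \<zeta> :: "'a ^ 's" assume "\<zeta> \<in> basis_vec ` {t. wt t = q}"
  then obtain t where t: "wt t = q" "\<zeta> = basis_vec t" by blast
  have "mono_of \<gamma> *s \<zeta> = axis (snd t) (mono_of \<gamma> * mono_of (fst t))"
    by (simp add: t(2) basis_vec_def vec_eq_iff axis_def)
  also have "\<dots> \<in> axis (snd t) ` span (mono_of ` {\<delta>. deg_of \<delta> = deg_of \<gamma> + deg_of (fst t)})"
    using mono_mult_degree by blast
  also have "\<dots> = L.span (axis (snd t) ` mono_of ` {\<delta>. deg_of \<delta> = deg_of \<gamma> + deg_of (fst t)})"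
    by (rule module_hom.span_image[symmetric, OF module_hom_axis])
  also have "\<dots> \<subseteq> L.span (basis_vec ` {t. wt t = deg_of \<gamma> + q})"
  proof (rule L.span_mono, clarify)
    fix \<delta> assume "deg_of \<delta> = deg_of \<gamma> + deg_of (fst t)"
    then show "axis (snd t) (mono_of \<delta>) \<in> basis_vec ` {t. wt t = deg_of \<gamma> + q}"
      using t(1) by (intro image_eqI[of _ _ "(\<delta>, snd t)"]) (auto simp: basis_vec_def wt_def)
  qed
  finally show "mono_of \<gamma> *s \<zeta> \<in> L.span (basis_vec ` {t. wt t = deg_of \<gamma> + q})" .
qed

lemma wt_lead: "\<xi> \<in> hom_component q \<Longrightarrow> \<xi> \<noteq> 0 \<Longrightarrow> wt (lead \<xi>) = q"
  unfolding hom_component_eq using lead_in by blast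

text \<open>Zero lies in every component, so the degree is determined only for nonzero elements,
  where it can be read off at the leading monomial.\<close>

lemma hom_component_deg_gr:
  assumes "\<xi> \<in> hom_component q" "\<xi> \<noteq> 0"
  shows "deg_gr \<xi> = q"
  unfolding deg_gr_def using assms wt_lead by (intro the_equality) auto

lemma subspace_hom_component: "L.subspace (hom_component q)"
  unfolding hom_component_eq by (rule subspace_supported)

end

section \<open>Submodules and Buchberger's criterion\<close>

context graded_free_module
begin

text \<open>For nonzero g, \<open>shift \<gamma> (lead g)\<close> is the leading monomial of
  a^\<gamma> g. The K-span for D = \<open>below t\<close> thus collects the elements having a
  representation by G whose leading monomials all stay below t.\<close>

definition multiples :: "('a ^ 's) set \<Rightarrow> (('n exponent) \<times> 's) set \<Rightarrow> ('a ^ 's) set" where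
  "multiples G D = {mono_of \<gamma> *s g |\<gamma> g. g \<in> G \<and> shift \<gamma> (lead g) \<in> D}"

lemma multiples_mono: "G \<subseteq> H \<Longrightarrow> D \<subseteq> E \<Longrightarrow> multiples G D \<subseteq> multiples H E"
  by (auto simp: multiples_def)

lemma subspace_left_span: "L.subspace (left_span (G :: ('a ^ 's) set))"
proof (rule L.subspaceI)
  show "0 \<in> left_span G"
    unfolding left_span_def by (intro CollectI exI[of _ "{}"]) simp
next
  fix x y assume "x \<in> left_span G" "y \<in> left_span G"
  then obtain F c F' c' where F: "finite F" "F \<subseteq> G" "x = (\<Sum>\<xi>\<in>F. c \<xi> *s \<xi>)"
    and F': "finite F'" "F' \<subseteq> G" "y = (\<Sum>\<xi>\<in>F'. c' \<xi> *s \<xi>)"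
    unfolding left_span_def by blast
  \<comment> \<open>The two index sets may overlap, so both coefficient families are extended by 0
    before they are added.\<close>
  define d where "d \<xi> = (if \<xi> \<in> F then c \<xi> else 0) + (if \<xi> \<in> F' then c' \<xi> else 0)" for \<xi>
  have "x = (\<Sum>\<xi>\<in>F \<union> F'. (if \<xi> \<in> F then c \<xi> else 0) *s \<xi>)"
    unfolding F(3) using F(1) F'(1) by (intro sum.mono_neutral_cong_left) auto
  moreover have "y = (\<Sum>\<xi>\<in>F \<union> F'. (if \<xi> \<in> F' then c' \<xi> else 0) *s \<xi>)"
    unfolding F'(3) using F(1) F'(1) by (intro sum.mono_neutral_cong_left) auto
  ultimately have "x + y = (\<Sum>\<xi>\<in>F \<union> F'. d \<xi> *s \<xi>)"
    by (simp add: d_def vector_sadd_rdistrib sum.distrib)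
  then show "x + y \<in> left_span G"
    unfolding left_span_def using F F' by blast
next
  fix k x assume "x \<in> left_span G"
  then obtain F c where F: "finite F" "F \<subseteq> G" "x = (\<Sum>\<xi>\<in>F. c \<xi> *s \<xi>)"
    unfolding left_span_def by blast
  have "scaleL k (c \<xi> *s \<xi>) = scale k (c \<xi>) *s \<xi>" for \<xi>
    by (simp add: scaleL_def vec_eq_iff scale_mult_left)
  then have "scaleL k x = (\<Sum>\<xi>\<in>F. scale k (c \<xi>) *s \<xi>)"
    by (simp add: F(3) L.scale_sum_right)
  then show "scaleL k x \<in> left_span G"
    unfolding left_span_def using F(1,2) by (intro CollectI exI[of _ F] exI[of _ "\<lambda>\<xi>. scale k (c \<xi>)"]) simp
qed

text \<open>Expanding the coefficients from A in monomials turns A-linear combinations into K-linear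
  ones, so that linear algebra over K applies to submodules.\<close>

lemma left_span_eq: "left_span G = L.span (multiples G UNIV)"
proof
  show "L.span (multiples G UNIV) \<subseteq> left_span G"
  proof (rule L.span_minimal[OF _ subspace_left_span], rule subsetI)
    fix x assume "x \<in> multiples G UNIV"
    then obtain \<gamma> g where "g \<in> G" "x = mono_of \<gamma> *s g" by (auto simp: multiples_def)
    then show "x \<in> left_span G"
      unfolding left_span_def by (intro CollectI exI[of _ "{g}"] exI[of _ "\<lambda>_. mono_of \<gamma>"]) simp
  qed
  show "left_span G \<subseteq> L.span (multiples G UNIV)"
  proof
    fix x assume "x \<in> left_span G"
    then obtain F c where F: "finite F" "F \<subseteq> G" "x = (\<Sum>\<xi>\<in>F. c \<xi> *s \<xi>)"
      unfolding left_span_def by blast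
    have "c \<xi> *s \<xi> \<in> L.span (multiples G UNIV)" if "\<xi> \<in> F" for \<xi>
    proof -
      have "c \<xi> *s \<xi> \<in> (\<lambda>x. x *s \<xi>) ` span (range mono_of)"
        using in_span_monomials by blast
      also have "\<dots> = L.span ((\<lambda>x. x *s \<xi>) ` range mono_of)"
        by (rule module_hom.span_image[symmetric, OF module_hom_right_smult])
      also have "\<dots> \<subseteq> L.span (multiples G UNIV)"
        using that F(2) by (intro L.span_mono) (auto simp: multiples_def)
      finally show ?thesis .
    qed
    then show "x \<in> L.span (multiples G UNIV)"
      unfolding F(3) by (rule L.span_sum)
  qed
qed

lemma left_span_mono: "G \<subseteq> H \<Longrightarrow> left_span G \<subseteq> left_span (H :: ('a ^ 's) set)"
  unfolding left_span_eq by (intro L.span_mono multiples_mono) auto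

lemma left_span_base:
  assumes "g \<in> G" shows "g \<in> left_span (G :: ('a ^ 's) set)"
  unfolding left_span_def using assms
  by (intro CollectI exI[of _ "{g}"] exI[of _ "\<lambda>_. 1"]) simp

lemma left_span_smult:
  assumes "\<xi> \<in> left_span (G :: ('a ^ 's) set)"
  shows "x *s \<xi> \<in> left_span G"
proof -
  obtain F c where F: "finite F" "F \<subseteq> G" "\<xi> = (\<Sum>\<zeta>\<in>F. c \<zeta> *s \<zeta>)"
    using assms unfolding left_span_def by blast
  interpret h: module_hom scaleL scaleL "\<lambda>\<xi> :: 'a ^ 's. x *s \<xi>"
    by (rule module_hom_left_smult)
  have "x *s \<xi> = (\<Sum>\<zeta>\<in>F. (x * c \<zeta>) *s \<zeta>)"
    by (simp add: F(3) h.sum vector_smult_assoc)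
  then show ?thesis
    unfolding left_span_def using F(1,2) by (intro CollectI exI[of _ F] exI[of _ "\<lambda>\<zeta>. x * c \<zeta>"]) simp
qed

lemma left_span_minimal:
  assumes "G \<subseteq> left_span (H :: ('a ^ 's) set)"
  shows "left_span G \<subseteq> left_span H"
  unfolding left_span_eq[of G]
  by (rule L.span_minimal[OF _ subspace_left_span])
    (use assms left_span_smult in \<open>auto simp: multiples_def\<close>)

lemma left_span_insert_absorb:
  assumes "\<xi> \<in> left_span (G :: ('a ^ 's) set)"
  shows "left_span (insert \<xi> G) = left_span G"
proof
  show "left_span (insert \<xi> G) \<subseteq> left_span G"
    using assms left_span_base by (intro left_span_minimal) auto
qed (auto intro: left_span_mono[THEN subsetD])

text \<open>The noncommutative correction: a^\<gamma> a^\<delta> differs from a multiple of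
  a^(\<gamma>+\<delta>) by lower monomials, and these contribute multiples of the same g with
  smaller leading monomial.\<close>

lemma smult_smult_mono:
  obtains c \<zeta> where "c \<noteq> 0" "mono_of \<gamma> *s (mono_of \<delta> *s g) = scaleL c (mono_of (\<gamma> + \<delta>) *s g) + \<zeta>"
    "\<zeta> \<in> L.span (multiples {g} (below (shift (\<gamma> + \<delta>) (lead g))))"
proof -
  obtain c f where cf: "c \<noteq> 0" "mono_of \<gamma> * mono_of \<delta> = scale c (mono_of (\<gamma> + \<delta>)) + f"
    "f \<in> span (mono_of ` {\<epsilon>. prec \<epsilon> (\<gamma> + \<delta>)})"
    by (rule mono_mult)
  interpret h: module_hom scale scaleL "\<lambda>x. x *s g"
    by (rule module_hom_right_smult)
  have "mono_of \<gamma> *s (mono_of \<delta> *s g) = scaleL c (mono_of (\<gamma> + \<delta>) *s g) + f *s g"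
    by (simp add: vector_smult_assoc cf(2) h.add h.scale)
  moreover have "f *s g \<in> L.span (multiples {g} (below (shift (\<gamma> + \<delta>) (lead g))))"
  proof -
    have "f *s g \<in> (\<lambda>x. x *s g) ` span (mono_of ` {\<epsilon>. prec \<epsilon> (\<gamma> + \<delta>)})"
      using cf(3) by blast
    also have "\<dots> = L.span ((\<lambda>x. x *s g) ` mono_of ` {\<epsilon>. prec \<epsilon> (\<gamma> + \<delta>)})"
      by (rule h.span_image[symmetric])
    also have "\<dots> \<subseteq> L.span (multiples {g} (below (shift (\<gamma> + \<delta>) (lead g))))"
    proof (rule L.span_mono, clarify)
      fix \<epsilon> assume e: "prec \<epsilon> (\<gamma> + \<delta>)"
      \<comment> \<open>Exponents commute, so the multiplier \<epsilon> may be compared first,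
        inside the component of g, and the exponent of \<open>lead g\<close> added
        afterwards.\<close>
      have "precL (shift (fst (lead g)) (\<epsilon>, snd (lead g))) (shift (fst (lead g)) (\<gamma> + \<delta>, snd (lead g)))"
        by (intro precL_shift precL_compatible e)
      then have "precL (shift \<epsilon> (lead g)) (shift (\<gamma> + \<delta>) (lead g))"
        by (simp add: shift_def add.commute)
      then show "mono_of \<epsilon> *s g \<in> multiples {g} (below (shift (\<gamma> + \<delta>) (lead g)))"
        by (auto simp: multiples_def)
    qed
    finally show ?thesis .
  qed
  ultimately show thesis using that cf(1) by blast
qed

text \<open>Bounded representations survive multiplication by a monomial, because the correction
  terms lie below the multiples they correct and hence below the moved bound.\<close>

lemma smult_span_multiples_below:
  assumes "\<xi> \<in> L.span (multiples G (below t))"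
  shows "mono_of \<gamma> *s \<xi> \<in> L.span (multiples G (below (shift \<gamma> t)))"
  using assms
proof (rule span_smult[rotated])
  fix \<zeta> assume "\<zeta> \<in> multiples G (below t)"
  then obtain \<delta> g where g: "g \<in> G" "precL (shift \<delta> (lead g)) t" "\<zeta> = mono_of \<delta> *s g"
    by (auto simp: multiples_def)
  obtain c \<eta> where c: "mono_of \<gamma> *s (mono_of \<delta> *s g) = scaleL c (mono_of (\<gamma> + \<delta>) *s g) + \<eta>"
    "\<eta> \<in> L.span (multiples {g} (below (shift (\<gamma> + \<delta>) (lead g))))"
    by (rule smult_smult_mono)
  have lt: "precL (shift (\<gamma> + \<delta>) (lead g)) (shift \<gamma> t)"
    using precL_shift[OF g(2), of \<gamma>] by (simp add: shift_shift)
  have "multiples {g} (below (shift (\<gamma> + \<delta>) (lead g))) \<subseteq> multiples G (below (shift \<gamma> t))"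
    using g(1) lt by (intro multiples_mono) (auto intro: precL_trans)
  then have "\<eta> \<in> L.span (multiples G (below (shift \<gamma> t)))"
    using c(2) L.span_mono by blast
  moreover have "mono_of (\<gamma> + \<delta>) *s g \<in> multiples G (below (shift \<gamma> t))"
    using g(1) lt by (auto simp: multiples_def)
  ultimately show "mono_of \<gamma> *s \<zeta> \<in> L.span (multiples G (below (shift \<gamma> t)))"
    unfolding g(3) c(1) by (intro L.span_add L.span_scale) (auto intro: L.span_base)
qed

definition down_closed :: "(('n exponent) \<times> 's) set \<Rightarrow> bool" where
  "down_closed D \<longleftrightarrow> (\<forall>s t. t \<in> D \<and> precL s t \<longrightarrow> s \<in> D)"

lemma down_closed_below: "down_closed (below t)"
  unfolding down_closed_def using precL_trans by blast

lemma span_multiples_supported: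
  assumes "0 \<notin> G" "down_closed D"
  shows "L.span (multiples G D) \<subseteq> supported D"
proof (rule L.span_minimal[OF _ subspace_supported], rule subsetI)
  fix x assume "x \<in> multiples G D"
  then obtain \<gamma> g where g: "g \<in> G" "shift \<gamma> (lead g) \<in> D" "x = mono_of \<gamma> *s g"
    by (auto simp: multiples_def)
  then have "lead x \<in> D" using assms(1) lead_smult(1)[of g \<gamma>] by metis
  then have "t \<in> D" if "cf x t \<noteq> 0" for t
    using lead_le[OF that] assms(2) unfolding down_closed_def by metis
  then show "x \<in> supported D"
    unfolding supported_def by blast
qed

text \<open>This is projection to degree q: since the generators are homogeneous, those of degree q
  can be kept and the others dropped.\<close>

lemma span_hom_part:
  assumes "v \<in> L.span T" "\<And>x. x \<in> T \<Longrightarrow> homogeneous x"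
  shows "\<exists>w\<in>L.span (T \<inter> hom_component q). \<forall>t. cf w t = (if wt t = q then cf v t else 0)"
  using assms(1)
proof (induction rule: L.span_induct_alt)
  case base
  then show ?case by (intro bexI[of _ 0]) (auto intro: L.span_zero)
next
  case (step c x y)
  then obtain w where w: "w \<in> L.span (T \<inter> hom_component q)" "\<And>t. cf w t = (if wt t = q then cf y t else 0)"
    by blast
  obtain p where p: "x \<in> hom_component p"
    using assms(2)[OF step(1)] by (auto simp: homogeneous_def)
  then have 0: "wt t \<noteq> p \<Longrightarrow> cf x t = 0" for t
    unfolding hom_component_eq supported_def by blast
  show ?case
  proof (cases "p = q")
    case True
    then have "scaleL c x + w \<in> L.span (T \<inter> hom_component q)"
      using p step(1) w(1) by (intro L.span_add L.span_scale) (auto intro: L.span_base)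
    then show ?thesis
      using w(2) 0 True by (intro bexI) (auto simp: cf_add cf_scaleL)
  next
    case False
    then show ?thesis
      using w 0 by (intro bexI[of _ w]) (auto simp: cf_add cf_scaleL)
  qed
qed

lemma span_hom_component:
  assumes "v \<in> L.span T" "\<And>x. x \<in> T \<Longrightarrow> homogeneous x" "v \<in> hom_component q"
  shows "v \<in> L.span (T \<inter> hom_component q)"
proof -
  obtain w where w: "w \<in> L.span (T \<inter> hom_component q)" "\<And>t. cf w t = (if wt t = q then cf v t else 0)"
    using span_hom_part[OF assms(1,2)] by blast
  have "w = v"
    by (rule cf_eqI) (use assms(3) in \<open>auto simp: w(2) hom_component_eq supported_def\<close>)
  then show ?thesis using w(1) by simp
qed

lemma homogeneous_smult: "homogeneous g \<Longrightarrow> homogeneous (mono_of \<gamma> *s g)"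
  unfolding homogeneous_def using smult_hom_component by blast

lemma homogeneous_multiples: "\<forall>g\<in>G. homogeneous g \<Longrightarrow> x \<in> multiples G D \<Longrightarrow> homogeneous x"
  by (auto simp: multiples_def homogeneous_smult)

text \<open>Stated as a bounded representation rather than through division: in this form it
  persists when G grows (\<open>S_resolved_mono\<close>) and becomes true once a nonzero remainder
  is added to G (\<open>S_resolved_insert\<close>).\<close>

definition S_resolved :: "('a ^ 's) set \<Rightarrow> 'a ^ 's \<Rightarrow> 'a ^ 's \<Rightarrow> bool" where
  "S_resolved G g h \<longleftrightarrow> S_poly g h \<in> L.span (multiples G (below (lcm_exp g h, snd (lead g))))"

lemma lcm_exp_commute: "lcm_exp g h = lcm_exp h g"
  by (simp add: lcm_exp_def vec_eq_iff max.commute)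

lemma S_poly_uminus: "S_poly h g = - S_poly g h"
  by (simp add: S_poly_def lcm_exp_commute[of h g] Let_def)

lemma S_resolved_commute:
  "snd (lead g) = snd (lead h) \<Longrightarrow> S_resolved G h g \<longleftrightarrow> S_resolved G g h"
  unfolding S_resolved_def S_poly_uminus[of h g] lcm_exp_commute[of h g]
  using L.span_neg by fastforce

lemma S_deg_commute: "snd (lead g) = snd (lead h) \<Longrightarrow> S_deg h g = S_deg g h"
  by (simp add: S_deg_def lcm_exp_commute[of h g])

lemma S_resolved_mono:
  assumes "G \<subseteq> H" "S_resolved G g h"
  shows "S_resolved H g h"
  using assms L.span_mono[OF multiples_mono] unfolding S_resolved_def by blast

text \<open>The core of Buchberger's argument. A common leading monomial t is divisible by the lcm
  of the two leading monomials, and the corresponding multiple of the S-polynomial relates the two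
  given multiples modulo lower ones.\<close>

lemma multiples_same_lead:
  assumes G: "0 \<notin> G" "g \<in> G" "h \<in> G"
    and lead: "shift \<gamma> (lead g) = t" "shift \<delta> (lead h) = t"
    and res: "g = h \<or> S_resolved G g h"
  shows "mono_of \<gamma> *s g \<in> L.span (insert (mono_of \<delta> *s h) (multiples G (below t)))"
proof (cases "g = h")
  case True
  then have "\<gamma> = \<delta>" using lead by (simp add: shift_def prod_eq_iff) (metis add_right_cancel)
  then show ?thesis using True by (simp add: L.span_base)
next
  case False
  define V where "V = L.span (multiples G (below t))"
  define l where "l = lcm_exp g h"
  \<comment> \<open>The quotient of t by the lcm; multiplying the S-polynomial by a^\<theta> lifts
    its bound from the lcm to t.\<close>
  define \<theta> where "\<theta> = fst t - l"
  define u where "u = mono_of (l - fst (lead g)) *s g"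
  define v where "v = mono_of (l - fst (lead h)) *s h"
  have g0: "g \<noteq> 0" "h \<noteq> 0" using G by auto
  have nz: "LC u \<noteq> 0" using g0 by (simp add: u_def LC_nonzero lead_smult)
  have comp: "l $ k = max (fst (lead g) $ k) (fst (lead h) $ k)"
    "fst t $ k = \<gamma> $ k + fst (lead g) $ k" "fst t $ k = \<delta> $ k + fst (lead h) $ k" for k
    unfolding l_def lcm_exp_def
    using arg_cong[OF lead(1), of "\<lambda>u. fst u $ k"] arg_cong[OF lead(2), of "\<lambda>u. fst u $ k"]
    by (simp_all add: shift_def)
  have "\<theta> $ k + (l $ k - fst (lead g) $ k) = \<gamma> $ k" "\<theta> $ k + (l $ k - fst (lead h) $ k) = \<delta> $ k"
    "\<theta> $ k + l $ k = fst t $ k" for k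
    using comp[of k] unfolding \<theta>_def vector_minus_component by linarith+
  then have th: "\<theta> + (l - fst (lead g)) = \<gamma>" "\<theta> + (l - fst (lead h)) = \<delta>" "\<theta> + l = fst t"
    by (simp_all add: vec_eq_iff)
  have S: "mono_of \<theta> *s S_poly g h \<in> V"
  proof -
    have "S_poly g h \<in> L.span (multiples G (below (l, snd (lead g))))"
      using res False by (simp add: S_resolved_def l_def)
    moreover have "shift \<theta> (l, snd (lead g)) = t"
      using th(3) lead(1) by (auto simp: shift_def)
    ultimately show ?thesis unfolding V_def using smult_span_multiples_below by metis
  qed
  have sub: "L.span (multiples {f} (below t)) \<subseteq> V" if "f \<in> G" for f
    unfolding V_def using that by (intro L.span_mono multiples_mono) auto
  \<comment> \<open>Multiplying u by a^\<theta> does not return a^\<gamma> g itself, but a nonzero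
    scalar multiple of it plus lower multiples of g.\<close>
  obtain c \<zeta> where c: "c \<noteq> 0" "mono_of \<theta> *s u = scaleL c (mono_of \<gamma> *s g) + \<zeta>"
    and "\<zeta> \<in> L.span (multiples {g} (below t))"
    by (rule smult_smult_mono[of \<theta> "l - fst (lead g)" g, unfolded th lead, folded u_def])
  then have \<zeta>: "\<zeta> \<in> V" using sub[OF G(2)] by blast
  obtain d \<eta> where d: "mono_of \<theta> *s v = scaleL d (mono_of \<delta> *s h) + \<eta>"
    and "\<eta> \<in> L.span (multiples {h} (below t))"
    by (rule smult_smult_mono[of \<theta> "l - fst (lead h)" h, unfolded th lead, folded v_def])
  then have \<eta>: "\<eta> \<in> V" using sub[OF G(3)] by blast
  interpret h: module_hom scaleL scaleL "\<lambda>\<xi> :: 'a ^ 's. mono_of \<theta> *s \<xi>"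
    by (rule module_hom_left_smult)
  define x where "x = mono_of \<gamma> *s g"
  define y where "y = mono_of \<delta> *s h"
  have "S_poly g h = scaleL (1 / LC u) u - scaleL (1 / LC v) v"
    by (simp add: S_poly_def Let_def l_def u_def v_def)
  then have "mono_of \<theta> *s S_poly g h = scaleL (1 / LC u) (scaleL c x + \<zeta>) - scaleL (1 / LC v) (scaleL d y + \<eta>)"
    by (simp add: h.diff h.scale c(2) d x_def y_def)
  \<comment> \<open>Solve for x, the multiple of g; its coefficient c / LC u is nonzero and is
    divided out at the end.\<close>
  then have "scaleL (c / LC u) x = mono_of \<theta> *s S_poly g h - scaleL (1 / LC u) \<zeta> + scaleL (1 / LC v) \<eta> +
      scaleL (d / LC v) y"
    by (simp add: L.scale_right_distrib algebra_simps)
  moreover have "V \<subseteq> L.span (insert y (multiples G (below t)))" "y \<in> L.span (insert y (multiples G (below t)))"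
    unfolding V_def by (auto intro: L.span_base L.span_mono[THEN subsetD])
  ultimately have "scaleL (c / LC u) x \<in> L.span (insert y (multiples G (below t)))"
    using S \<zeta> \<eta> by (auto intro!: L.span_add L.span_diff L.span_scale)
  then have "scaleL (LC u / c) (scaleL (c / LC u) x) \<in> L.span (insert y (multiples G (below t)))"
    by (rule L.span_scale)
  then show ?thesis using nz c(1) by (simp add: x_def y_def)
qed

text \<open>A combination involves finitely many leading monomials, and the largest of them bounds
  all. This produces the closed bounds on which well-founded induction runs; nonzero v rules out the
  empty combination, which has no largest monomial.\<close>

lemma span_multiples_bounded:
  assumes "v \<in> L.span (multiples G D \<inter> H)" "v \<noteq> 0"
  shows "\<exists>s\<in>D. v \<in> L.span (multiples G (insert s (below s)) \<inter> H)"
proof -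
  have "v = 0 \<or> (\<exists>s\<in>D. v \<in> L.span (multiples G (insert s (below s)) \<inter> H))"
    using assms(1)
  proof (induction rule: L.span_induct_alt)
    case base
    then show ?case by simp
  next
    case (step c x y)
    let ?V = "\<lambda>s. L.span (multiples G (insert s (below s)) \<inter> H)"
    obtain s where s: "s \<in> D" "x \<in> multiples G (insert s (below s)) \<inter> H"
      using step(1) unfolding multiples_def by blast
    have mono: "?V s \<subseteq> ?V s'" if "s = s' \<or> precL s s'" for s s'
    proof -
      have "insert s (below s) \<subseteq> insert s' (below s')" using that by (blast intro: precL_trans)
      then show ?thesis by (intro L.span_mono Int_mono multiples_mono) auto
    qed
    have "\<exists>s\<in>D. x \<in> ?V s \<and> y \<in> ?V s"
    proof (cases "y = 0")
      case True
      then show ?thesis using s L.span_base L.span_zero by blast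
    next
      case False
      then obtain s' where s': "s' \<in> D" "y \<in> ?V s'" using step by blast
      have x: "x \<in> ?V s" using s(2) by (rule L.span_base)
      show ?thesis
      proof (cases "precL s s'")
        case True
        then show ?thesis using mono[of s s'] x s' by blast
      next
        case False
        then have "?V s' \<subseteq> ?V s" using precL_linear[of s s'] by (intro mono) auto
        then show ?thesis using x s s' by blast
      qed
    qed
    then show ?case by (auto intro!: L.span_add L.span_scale)
  qed
  then show ?thesis using assms(2) by blast
qed

text \<open>
  Well-founded induction on a bound for the leading monomials of the multiples that represent \<open>f\<close>:
  if \<open>lead f\<close> is below the bound \<open>t\<close>, the multiples with leading monomial \<open>t\<close> cancel, and resolved
  S-polynomials allow them to be replaced by smaller ones.
\<close>

lemma buchberger_truncated:
  assumes G: "0 \<notin> G" "\<forall>g\<in>G. homogeneous g"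
    and res: "\<And>g h. g \<in> G \<Longrightarrow> h \<in> G \<Longrightarrow> snd (lead g) = snd (lead h) \<Longrightarrow> S_deg g h \<le> q \<Longrightarrow>
      g = h \<or> S_resolved G g h"
    and f: "f \<in> left_span G" "f \<in> hom_component q" "f \<noteq> 0"
  shows "\<exists>g\<in>G. mono_dvd (lead g) (lead f)"
proof -
  let ?H = "hom_component q"
  have claim: "\<forall>f. f \<noteq> 0 \<longrightarrow> f \<in> L.span (multiples G (insert t (below t)) \<inter> ?H) \<longrightarrow>
      (\<exists>g\<in>G. mono_dvd (lead g) (lead f))" for t
  proof (induction t rule: wfp_induct[OF precL_wf])
    case (1 t)
    note IH = 1[rule_format]
    show ?case
    proof (intro allI impI)
      fix f assume f0: "f \<noteq> 0" and f: "f \<in> L.span (multiples G (insert t (below t)) \<inter> ?H)"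
      \<comment> \<open>An open bound at t is not an instance of the induction hypothesis; it is
        first tightened to a closed bound at some s below t.\<close>
      have low: "\<exists>g\<in>G. mono_dvd (lead g) (lead f)" if fl: "f \<in> L.span (multiples G (below t) \<inter> ?H)"
      proof -
        obtain s where "precL s t" "f \<in> L.span (multiples G (insert s (below s)) \<inter> ?H)"
          using span_multiples_bounded[OF fl f0] by auto
        then show ?thesis using IH f0 by blast
      qed
      show "\<exists>g\<in>G. mono_dvd (lead g) (lead f)"
      proof (cases "multiples G {t} \<inter> ?H = {}")
        case True
        have "multiples G (insert t (below t)) = multiples G {t} \<union> multiples G (below t)"
          by (auto simp: multiples_def)
        then show ?thesis using f True low by (simp add: Int_Un_distrib2)
      next
        case False
        \<comment> \<open>One multiple with leading monomial t serves as pivot; all others with the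
          same leading monomial are compared with it.\<close>
        then obtain \<delta> h where h: "h \<in> G" "shift \<delta> (lead h) = t" "mono_of \<delta> *s h \<in> ?H"
          by (auto simp: multiples_def)
        define y where "y = mono_of \<delta> *s h"
        have h0: "h \<noteq> 0" using h(1) G(1) by auto
        have y: "lead y = t" "y \<noteq> 0" using lead_smult[OF h0, of \<delta>] h(2) by (auto simp: y_def)
        have wt: "wt t = q" using wt_lead[of y] y h(3) by (simp add: y_def)
        have top: "x \<in> L.span (insert y (multiples G (below t) \<inter> ?H))"
          if x: "x \<in> multiples G {t} \<inter> ?H" for x
        proof -
          obtain \<gamma> g where g: "g \<in> G" "shift \<gamma> (lead g) = t" "x = mono_of \<gamma> *s g"
            using x by (auto simp: multiples_def)
          have comp: "snd (lead g) = snd (lead h)" using g(2) h(2) by (auto simp: shift_def)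
          \<comment> \<open>Both leading monomials divide t, hence so does their lcm, and the
            truncated subtraction is exact. So the degree of the S-polynomial is at most the degree
            q of t, and \<open>res\<close> applies.\<close>
          have "fst t = (fst t - lcm_exp g h) + lcm_exp g h"
          proof -
            have "fst (lead g) $ k \<le> fst t $ k" "fst (lead h) $ k \<le> fst t $ k" for k
              using arg_cong[OF g(2), of "\<lambda>u. fst u $ k"] arg_cong[OF h(2), of "\<lambda>u. fst u $ k"]
              by (simp_all add: shift_def)
            then show ?thesis by (simp add: vec_eq_iff lcm_exp_def)
          qed
          then have "deg_of (lcm_exp g h) \<le> deg_of (fst t)"
            by (metis deg_of_add le_add2)
          moreover have "snd (lead g) = snd t" using g(2) by (auto simp: shift_def)
          ultimately have "S_deg g h \<le> q" using wt by (simp add: S_deg_def wt_def)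
          then have "x \<in> L.span (insert y (multiples G (below t)))"
            unfolding y_def g(3)
            using multiples_same_lead[OF G(1) g(1) h(1) g(2) h(2)] res[OF g(1) h(1) comp] by blast
          \<comment> \<open>Lower multiples of other degrees may have entered. As x and all
            generators are homogeneous, they can be discarded.\<close>
          then have "x \<in> L.span (insert y (multiples G (below t)) \<inter> ?H)"
            by (rule span_hom_component)
              (use x h G(2) homogeneous_multiples[OF G(2)] homogeneous_smult in \<open>auto simp: y_def\<close>)
          then show ?thesis using h(3) by (simp add: y_def)
        qed
        have "L.span (multiples G (insert t (below t)) \<inter> ?H) \<subseteq> L.span (insert y (multiples G (below t) \<inter> ?H))"
        proof (rule L.span_minimal[OF _ L.subspace_span], rule subsetI)
          fix x assume "x \<in> multiples G (insert t (below t)) \<inter> ?H"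
          then have "x \<in> multiples G {t} \<inter> ?H \<or> x \<in> multiples G (below t) \<inter> ?H"
            by (auto simp: multiples_def)
          then show "x \<in> L.span (insert y (multiples G (below t) \<inter> ?H))"
            using top by (auto intro: L.span_base)
        qed
        \<comment> \<open>Modulo lower multiples f equals k y. For k = 0 the bound drops below t;
          for nonzero k the monomial t survives in f and is its leading monomial, divisible by that
          of h.\<close>
        then obtain k where k: "f - scaleL k y \<in> L.span (multiples G (below t) \<inter> ?H)"
          using f L.span_breakdown_eq by blast
        show ?thesis
        proof (cases "k = 0")
          case True
          then show ?thesis using k low by simp
        next
          case False
          have "L.span (multiples G (below t) \<inter> ?H) \<subseteq> supported (below t)"
            using span_multiples_supported[OF G(1) down_closed_below] L.span_mono[OF Int_lower1] by blast
          then have r: "f - scaleL k y \<in> supported (below t)" using k by blast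
          have f_eq: "cf f s = cf (f - scaleL k y) s + k * cf y s" for s
            by (simp add: cf_diff cf_scaleL)
          have "cf (f - scaleL k y) t = 0" using r precL_irrefl supportedD by blast
          then have "cf f t \<noteq> 0" using f_eq[of t] False lead_props(1)[OF y(2)] y(1) by simp
          moreover have "f \<in> supported (insert t (below t))"
          proof -
            have "s \<in> insert t (below t)" if "cf f s \<noteq> 0" for s
            proof -
              have "cf (f - scaleL k y) s \<noteq> 0 \<or> cf y s \<noteq> 0" using that f_eq[of s] by auto
              then show ?thesis
                using supportedD[OF r] supportedD[OF lead_props(2)[OF y(2)]] unfolding y(1) by blast
            qed
            then show ?thesis by (simp add: supported_def)
          qed
          ultimately have "lead f = t" by (rule lead_eqI)
          then have "mono_dvd (lead h) (lead f)" using h(2) unfolding mono_dvd_iff_shift by metis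
          then show ?thesis using h(1) by blast
        qed
      qed
    qed
  qed
  have "f \<in> L.span (multiples G UNIV \<inter> ?H)"
    using span_hom_component[OF _ homogeneous_multiples[OF G(2)]] f by (simp add: left_span_eq)
  from span_multiples_bounded[OF this f(3)]
  obtain s where "f \<in> L.span (multiples G (insert s (below s)) \<inter> ?H)" by (elim bexE)
  with f(3) show ?thesis by (rule claim[rule_format])
qed

text \<open>The homogeneous part of f in the degree of its leading monomial keeps that leading
  monomial and stays in the left span, so the truncated criterion can be applied to this
  part.\<close>

lemma buchberger:
  assumes G: "0 \<notin> G" "\<forall>g\<in>G. homogeneous g"
    and res: "\<And>g h. g \<in> G \<Longrightarrow> h \<in> G \<Longrightarrow> snd (lead g) = snd (lead h) \<Longrightarrow> g = h \<or> S_resolved G g h"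
    and f: "f \<in> left_span G" "f \<noteq> 0"
  shows "\<exists>g\<in>G. mono_dvd (lead g) (lead f)"
proof -
  define q where "q = wt (lead f)"
  have "f \<in> L.span (multiples G UNIV)" using f(1) by (simp add: left_span_eq)
  moreover have "homogeneous x" if "x \<in> multiples G UNIV" for x
    using G(2) that by (rule homogeneous_multiples)
  ultimately have "\<exists>w\<in>L.span (multiples G UNIV \<inter> hom_component q). \<forall>t. cf w t = (if wt t = q then cf f t else 0)"
    by (rule span_hom_part)
  then
  obtain w where w: "w \<in> L.span (multiples G UNIV \<inter> hom_component q)"
    "\<forall>t. cf w t = (if wt t = q then cf f t else 0)"
    by (elim bexE)
  have nz: "cf w (lead f) \<noteq> 0" using lead_props(1)[OF f(2)] by (simp add: w(2) q_def)
  have "w \<in> supported (insert (lead f) (below (lead f)))"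
    using supportedD[OF lead_props(2)[OF f(2)]] unfolding supported_def by (auto simp: w(2))
  with nz have lead: "lead w = lead f" by (rule lead_eqI)
  have "\<exists>g\<in>G. mono_dvd (lead g) (lead w)"
  proof (rule buchberger_truncated[OF G])
    show "g = h \<or> S_resolved G g h" if "g \<in> G" "h \<in> G" "snd (lead g) = snd (lead h)" for g h
      using that by (rule res)
    show "w \<in> left_span G"
      using w(1) L.span_mono[OF Int_lower1] unfolding left_span_eq by blast
    show "w \<in> hom_component q" by (simp add: hom_component_eq supported_def w(2))
    show "w \<noteq> 0" using nz by auto
  qed
  then show ?thesis by (simp add: lead)
qed

end

section \<open>Division\<close>

context graded_free_module
begin

lemma division_step_supported:
  assumes "division_step P (\<xi>, r) (\<xi>', r')" "0 \<notin> P"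
  shows "\<xi>' \<in> supported (below (lead \<xi>))"
  using assms(1)
proof cases
  case (reduce p \<gamma>)
  let ?x = "mono_of \<gamma> *s p"
  have x: "?x \<noteq> 0" using reduce assms(2) lead_smult(2) by metis
  have "cf \<xi> (lead \<xi>) = LC \<xi> / LC ?x * cf ?x (lead \<xi>)"
    using LC_nonzero[OF x] reduce(6) by (simp add: LC_eq)
  then show ?thesis
    unfolding reduce(1) using lead_props(2)[OF reduce(3)] lead_props(2)[OF x] reduce(6)
    by (intro supported_cancel_term) simp_all
next
  case shift
  show ?thesis
    unfolding shift(1) LT_eq using lead_props(2)[OF shift(3)]
    by (intro supported_cancel_term) (auto simp: LC_eq cf_basis_vec supported_def split: if_splits)
qed

text \<open>A rule applies to every nonzero dividend and strictly lowers its leading monomial. The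
  partial remainder r never influences a step, so it is arbitrary in the induction.\<close>

lemma remainder_exists:
  assumes "0 \<notin> P"
  shows "\<exists>\<eta>. is_remainder P \<xi> \<eta>"
proof -
  have step: "\<exists>\<xi>' r'. division_step P (\<xi>, r) (\<xi>', r')" if "\<xi> \<noteq> 0" for \<xi> r
  proof (cases "\<forall>p\<in>P. \<not> mono_dvd (lead p) (lead \<xi>)")
    case True
    then show ?thesis using division_step.shift[OF that] by blast
  next
    case False
    then obtain p \<gamma> where p: "p \<in> P" "mono_dvd (lead p) (lead \<xi>)" "lead \<xi> = shift \<gamma> (lead p)"
      using mono_dvd_iff_shift by blast
    have "p \<noteq> 0" using p(1) assms by auto
    then have "lead \<xi> = lead (mono_of \<gamma> *s p)" using p(3) lead_smult by simp
    then show ?thesis using division_step.reduce[OF that p(1,2)] by blast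
  qed
  have main: "\<xi> \<in> supported (insert t (below t)) \<Longrightarrow> \<exists>\<eta>. (division_step P)\<^sup>*\<^sup>* (\<xi>, r) (0, \<eta>)" for t \<xi> r
  proof (induction t arbitrary: \<xi> r rule: wfp_induct_rule[OF precL_wf])
    case (1 t)
    show ?case
    proof (cases "\<xi> = 0")
      case False
      then obtain \<xi>' r' where s: "division_step P (\<xi>, r) (\<xi>', r')" using step by blast
      have low: "\<xi>' \<in> supported (below (lead \<xi>))" by (rule division_step_supported[OF s assms])
      show ?thesis
      proof (cases "\<xi>' = 0")
        case True
        then show ?thesis using s by blast
      next
        case False
        have "precL (lead \<xi>') (lead \<xi>)" using lead_in[OF False low] by simp
        moreover have "lead \<xi> = t \<or> precL (lead \<xi>) t" using lead_in[OF \<open>\<xi> \<noteq> 0\<close> 1(2)] by simp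
        ultimately have "precL (lead \<xi>') t" using precL_trans by metis
        then obtain \<eta> where "(division_step P)\<^sup>*\<^sup>* (\<xi>', r') (0, \<eta>)"
          using 1(1) lead_props(2)[OF False] by metis
        then show ?thesis using s by (meson converse_rtranclp_into_rtranclp)
      qed
    qed auto
  qed
  show ?thesis
  proof (cases "\<xi> = 0")
    case True
    then show ?thesis unfolding is_remainder_def by blast
  next
    case False
    then show ?thesis unfolding is_remainder_def using main[OF lead_props(2)] by blast
  qed
qed

text \<open>E is chosen according to use: all monomials for left spans and irreducibility, a lower
  set for S-polynomials, a degree class for homogeneity. The hypothesis \<open>closed\<close> says
  that a reduction at a monomial of E introduces no monomial outside E.\<close>

lemma remainder_props:
  assumes rem: "is_remainder P \<xi>\<^sub>0 \<eta>"
    and closed: "\<And>\<gamma> p. p \<in> P \<Longrightarrow> shift \<gamma> (lead p) \<in> E \<Longrightarrow> mono_of \<gamma> *s p \<in> supported E"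
    and P: "0 \<notin> P" and \<xi>\<^sub>0: "\<xi>\<^sub>0 \<in> supported E"
  shows "\<eta> \<in> supported E" "\<xi>\<^sub>0 - \<eta> \<in> L.span (multiples P E)"
    "\<forall>t. cf \<eta> t \<noteq> 0 \<longrightarrow> (\<forall>p\<in>P. \<not> mono_dvd (lead p) t)"
proof -
  define Inv where "Inv x \<longleftrightarrow> fst x \<in> supported E \<and>
    snd x \<in> supported (E \<inter> {t. \<forall>p\<in>P. \<not> mono_dvd (lead p) t}) \<and>
    \<xi>\<^sub>0 - fst x - snd x \<in> L.span (multiples P E)" for x
  have "(division_step P)\<^sup>*\<^sup>* (\<xi>\<^sub>0, 0) (0, \<eta>)" using rem by (simp add: is_remainder_def)
  then have "Inv (0, \<eta>)"
  proof (induction rule: rtranclp_induct)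
    case base
    then show ?case using \<xi>\<^sub>0 by (simp add: Inv_def L.span_zero supported_def)
  next
    case (step x y)
    from step(2) show ?case
    proof cases
      case (reduce \<xi> p \<gamma> r)
      let ?x = "mono_of \<gamma> *s p"
      have inv: "\<xi> \<in> supported E" "r \<in> supported (E \<inter> {t. \<forall>p\<in>P. \<not> mono_dvd (lead p) t})"
        "\<xi>\<^sub>0 - \<xi> - r \<in> L.span (multiples P E)"
        using step(3) by (simp_all add: Inv_def reduce(1))
      have "lead \<xi> \<in> E" using lead_in[OF reduce(3) inv(1)] .
      moreover have "lead \<xi> = shift \<gamma> (lead p)" using reduce P lead_smult(1) by metis
      ultimately have E: "shift \<gamma> (lead p) \<in> E" by simp
      then have "?x \<in> supported E" "?x \<in> L.span (multiples P E)"
        using closed[OF reduce(4)] reduce(4) by (auto intro!: L.span_base simp: multiples_def)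
      then have x: "scaleL c ?x \<in> supported E" "scaleL c ?x \<in> L.span (multiples P E)" for c
        by (auto intro: L.subspace_scale[OF subspace_supported] L.span_scale)
      have eq: "\<xi>\<^sub>0 - (\<xi> - scaleL c ?x) - r = (\<xi>\<^sub>0 - \<xi> - r) + scaleL c ?x" for c by simp
      show ?thesis
        unfolding Inv_def reduce(2) fst_conv snd_conv
        using L.subspace_diff[OF subspace_supported inv(1) x(1)] inv(2) L.span_add[OF inv(3) x(2)]
        unfolding eq by blast
    next
      case (shift \<xi> r)
      let ?E = "E \<inter> {t. \<forall>p\<in>P. \<not> mono_dvd (lead p) t}"
      have inv: "\<xi> \<in> supported E" "r \<in> supported ?E" "\<xi>\<^sub>0 - \<xi> - r \<in> L.span (multiples P E)"
        using step(3) by (simp_all add: Inv_def shift(1))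
      have "lead \<xi> \<in> ?E" using lead_in[OF shift(3) inv(1)] shift(4) by simp
      then have LT: "LT \<xi> \<in> supported ?E"
        by (auto simp: LT_eq supported_def cf_scaleL cf_basis_vec split: if_splits)
      then have LT': "LT \<xi> \<in> supported E" by (auto simp: supported_def)
      have eq: "\<xi>\<^sub>0 - (\<xi> - LT \<xi>) - (r + LT \<xi>) = \<xi>\<^sub>0 - \<xi> - r" by simp
      show ?thesis
        unfolding Inv_def shift(2) fst_conv snd_conv eq
        using L.subspace_diff[OF subspace_supported inv(1) LT'] inv(3)
          L.subspace_add[OF subspace_supported inv(2) LT] by blast
    qed
  qed
  then have "\<eta> \<in> supported (E \<inter> {t. \<forall>p\<in>P. \<not> mono_dvd (lead p) t})" "\<xi>\<^sub>0 - \<eta> \<in> L.span (multiples P E)"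
    by (simp_all add: Inv_def)
  then show "\<eta> \<in> supported E" "\<xi>\<^sub>0 - \<eta> \<in> L.span (multiples P E)"
    "\<forall>t. cf \<eta> t \<noteq> 0 \<longrightarrow> (\<forall>p\<in>P. \<not> mono_dvd (lead p) t)"
    by (auto simp: supported_def)
qed

lemma remainder_below:
  assumes "is_remainder P \<xi> \<eta>" "0 \<notin> P" "\<xi> \<in> supported (below t)"
  shows "\<eta> \<in> supported (below t)" "\<xi> - \<eta> \<in> L.span (multiples P (below t))"
proof -
  have "mono_of \<gamma> *s p \<in> supported (below t)" if "p \<in> P" "shift \<gamma> (lead p) \<in> below t" for \<gamma> p
  proof -
    have "mono_of \<gamma> *s p \<in> L.span (multiples P (below t))"
      using that by (intro L.span_base) (auto simp: multiples_def)
    then show ?thesis using span_multiples_supported[OF assms(2) down_closed_below] by (rule subsetD[rotated])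
  qed
  then show "\<eta> \<in> supported (below t)" "\<xi> - \<eta> \<in> L.span (multiples P (below t))"
    using remainder_props(1,2)[OF assms(1) _ assms(2,3)] by auto
qed

lemma remainder_left_span:
  assumes "is_remainder P \<xi> \<eta>" "0 \<notin> P"
  shows "\<xi> - \<eta> \<in> left_span P"
  using remainder_props(2)[OF assms(1), of UNIV] assms(2) by (simp add: left_span_eq supported_def)

lemma remainder_not_dvd:
  assumes "is_remainder P \<xi> \<eta>" "0 \<notin> P" "\<eta> \<noteq> 0" "p \<in> P"
  shows "\<not> mono_dvd (lead p) (lead \<eta>)"
proof -
  have "\<forall>t. cf \<eta> t \<noteq> 0 \<longrightarrow> (\<forall>p\<in>P. \<not> mono_dvd (lead p) t)"
    by (rule remainder_props(3)[OF assms(1), of UNIV]) (use assms(2) in \<open>simp_all add: supported_def\<close>)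
  then show ?thesis using assms(4) lead_props(1)[OF assms(3)] by blast
qed

lemma remainder_hom_component:
  assumes "is_remainder P \<xi> \<eta>" "0 \<notin> P" "\<forall>p\<in>P. homogeneous p" "\<xi> \<in> hom_component q"
  shows "\<eta> \<in> hom_component q"
  unfolding hom_component_eq
proof (rule remainder_props(1)[OF assms(1) _ assms(2) assms(4)[unfolded hom_component_eq]])
  fix \<gamma> p assume p: "p \<in> P" "shift \<gamma> (lead p) \<in> {t. wt t = q}"
  obtain q' where q': "p \<in> hom_component q'" using assms(3) p(1) by (auto simp: homogeneous_def)
  have "p \<noteq> 0" using p(1) assms(2) by auto
  then have "deg_of \<gamma> + q' = q" using p(2) wt_lead[OF q'] by (simp add: wt_shift)
  then show "mono_of \<gamma> *s p \<in> supported {t. wt t = q}"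
    using smult_hom_component[OF q', of \<gamma>] by (simp add: hom_component_eq)
qed

section \<open>S-polynomials: bounds, degrees and resolution\<close>

lemma mono_of_0: "mono_of 0 = 1"
proof -
  have "prod_list (map (\<lambda>i. a i ^ ((0 :: 'n exponent) $ i)) xs) = 1" for xs
    by (induction xs) simp_all
  then show ?thesis by (simp add: gen_monomial_def)
qed

lemma shift_0 [simp]: "shift 0 t = t"
  by (simp add: shift_def)

text \<open>Both multiples have the lcm as leading monomial and are scaled to leading coefficient 1,
  so this monomial cancels; its degree is the common degree of the two.\<close>

lemma
  assumes "g \<noteq> 0" "h \<noteq> 0" "snd (lead g) = snd (lead h)"
  shows S_poly_supported: "S_poly g h \<in> supported (below (lcm_exp g h, snd (lead g)))"
    and S_poly_hom_component: "homogeneous g \<Longrightarrow> homogeneous h \<Longrightarrow> S_poly g h \<in> hom_component (S_deg g h)"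
proof -
  define t where "t = (lcm_exp g h, snd (lead g))"
  define \<gamma> where "\<gamma> = lcm_exp g h - fst (lead g)"
  define \<delta> where "\<delta> = lcm_exp g h - fst (lead h)"
  define u where "u = mono_of \<gamma> *s g"
  define v where "v = mono_of \<delta> *s h"
  have S: "S_poly g h = scaleL (1 / LC u) u - scaleL (1 / LC v) v"
    by (simp add: S_poly_def Let_def u_def v_def \<gamma>_def \<delta>_def)
  have sh: "shift \<gamma> (lead g) = t" "shift \<delta> (lead h) = t"
    using assms(3) by (simp_all add: shift_def t_def \<gamma>_def \<delta>_def vec_eq_iff lcm_exp_def)
  have uv: "u \<noteq> 0" "v \<noteq> 0" "lead u = t" "lead v = t"
    using lead_smult assms sh by (simp_all add: u_def v_def)
  have "scaleL (1 / LC u) u \<in> supported (insert t (below t))"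
    using lead_props(2)[OF uv(1)] by (intro L.subspace_scale[OF subspace_supported]) (simp add: uv)
  moreover have "v \<in> supported (insert t (below t))" using lead_props(2)[OF uv(2)] by (simp add: uv)
  moreover have "cf (scaleL (1 / LC u) u) t = 1 / LC v * cf v t"
    using LC_nonzero[OF uv(1)] LC_nonzero[OF uv(2)] uv by (simp add: cf_scaleL LC_eq)
  ultimately have "S_poly g h \<in> supported (below t)"
    unfolding S by (rule supported_cancel_term)
  then show "S_poly g h \<in> supported (below (lcm_exp g h, snd (lead g)))" by (simp add: t_def)
  have hom: "mono_of \<epsilon> *s f \<in> hom_component (S_deg g h)"
    if "homogeneous f" "f \<noteq> 0" "shift \<epsilon> (lead f) = t" for \<epsilon> f
  proof -
    obtain q where q: "f \<in> hom_component q" using \<open>homogeneous f\<close> by (auto simp: homogeneous_def)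
    have "deg_of \<epsilon> + q = wt t" using wt_lead[OF q] that by (metis wt_shift)
    also have "\<dots> = S_deg g h" by (simp add: wt_def t_def S_deg_def)
    finally show ?thesis using smult_hom_component[OF q, of \<epsilon>] by simp
  qed
  show "S_poly g h \<in> hom_component (S_deg g h)" if "homogeneous g" "homogeneous h"
    unfolding S u_def v_def using hom that sh assms
    by (intro L.subspace_diff[OF subspace_hom_component] L.subspace_scale[OF subspace_hom_component]) auto
qed

lemma S_resolved_zero:
  assumes "g \<noteq> 0" "h \<noteq> 0" "snd (lead g) = snd (lead h)" "0 \<notin> G" "is_remainder G (S_poly g h) 0"
  shows "S_resolved G g h"
  using remainder_below(2)[OF assms(5,4) S_poly_supported[OF assms(1-3)]] by (simp add: S_resolved_def)

text \<open>The remainder, read as a^0 \<eta>, is itself a multiple below the lcm and supplies what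
  the multiples of G do not represent.\<close>

lemma S_resolved_insert:
  assumes gh: "g \<noteq> 0" "h \<noteq> 0" "snd (lead g) = snd (lead h)" and G: "0 \<notin> G"
    and \<eta>: "is_remainder G (S_poly g h) \<eta>" "\<eta> \<noteq> 0"
  shows "S_resolved (insert \<eta> G) g h"
proof -
  let ?t = "(lcm_exp g h, snd (lead g))"
  have \<eta>': "\<eta> \<in> supported (below ?t)" and d: "S_poly g h - \<eta> \<in> L.span (multiples G (below ?t))"
    using remainder_below[OF \<eta>(1) G S_poly_supported[OF gh]] by auto
  have "\<eta> = mono_of 0 *s \<eta>" by (simp add: mono_of_0)
  then have "\<eta> \<in> multiples (insert \<eta> G) (below ?t)"
    unfolding multiples_def using lead_in[OF \<eta>(2) \<eta>'] by (intro CollectI exI[of _ 0] exI[of _ \<eta>]) simp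
  moreover have "L.span (multiples G (below ?t)) \<subseteq> L.span (multiples (insert \<eta> G) (below ?t))"
    by (intro L.span_mono multiples_mono) auto
  ultimately have "(S_poly g h - \<eta>) + \<eta> \<in> L.span (multiples (insert \<eta> G) (below ?t))"
    using d by (intro L.span_add) (auto intro: L.span_base)
  then show ?thesis by (simp add: S_resolved_def)
qed

text \<open>By non-divisibility some exponent of \<open>lead g\<close> exceeds that of
  \<open>lead \<eta>\<close>, so the lcm is a proper multiple of \<open>lead \<eta>\<close> and has
  larger degree.\<close>

lemma S_deg_greater:
  assumes "\<eta> \<in> hom_component q" "\<eta> \<noteq> 0" "snd (lead g) = snd (lead \<eta>)" "\<not> mono_dvd (lead g) (lead \<eta>)"
  shows "q < S_deg g \<eta>"
proof -
  define \<delta> where "\<delta> = lcm_exp g \<eta> - fst (lead \<eta>)"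
  have l: "lcm_exp g \<eta> = \<delta> + fst (lead \<eta>)"
    by (simp add: \<delta>_def vec_eq_iff lcm_exp_def)
  obtain k where "fst (lead \<eta>) $ k < fst (lead g) $ k"
    using assms(3,4) by (auto simp: mono_dvd_iff_le not_le)
  then have "\<delta> $ k \<noteq> 0" by (simp add: \<delta>_def lcm_exp_def)
  then have "\<delta> \<noteq> 0" by auto
  then have "deg_of \<delta> > 0" using deg_of_eq_0_iff by (metis gr0I)
  then show ?thesis
    using wt_lead[OF assms(1,2)] assms(3) by (simp add: S_deg_def l deg_of_add wt_def)
qed

text \<open>If an old u became redundant, the relation could be cut down to the degree of u, where
  \<xi> occurs only with a coefficient from K; exchanging u and \<xi> would put \<xi> into the span
  of X.\<close>

lemma minimal_insert:
  assumes X: "\<forall>u\<in>X. \<exists>q\<le>\<nu>. u \<in> hom_component q" "\<forall>u\<in>X. u \<notin> left_span (X - {u})"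
    and \<xi>: "\<xi> \<in> hom_component \<nu>" "\<xi> \<notin> left_span X"
  shows "\<forall>u\<in>insert \<xi> X. u \<notin> left_span (insert \<xi> X - {u})"
proof
  fix u assume u: "u \<in> insert \<xi> X"
  show "u \<notin> left_span (insert \<xi> X - {u})"
  proof (cases "u = \<xi>")
    case True
    then show ?thesis using \<xi>(2) left_span_mono[of "insert \<xi> X - {u}" X] by auto
  next
    case False
    then have uX: "u \<in> X" using u by simp
    define Y where "Y = X - {u}"
    have Y: "insert \<xi> X - {u} = insert \<xi> Y" using False by (auto simp: Y_def)
    obtain q where q: "q \<le> \<nu>" "u \<in> hom_component q" using X(1) uX by blast
    have \<xi>0: "\<xi> \<noteq> 0" using \<xi>(2) L.subspace_0[OF subspace_left_span[of X]] by auto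
    have hom: "homogeneous x" if "x \<in> multiples (insert \<xi> Y) UNIV" for x
    proof (rule homogeneous_multiples[OF _ that], rule ballI)
      fix g assume "g \<in> insert \<xi> Y"
      then show "homogeneous g" using X(1) \<xi>(1) by (auto simp: homogeneous_def Y_def)
    qed
    \<comment> \<open>A multiple a^\<gamma> \<xi> of degree q \<le> \<nu> must have \<gamma> of
      degree 0, so it is \<xi> itself.\<close>
    have sub: "multiples (insert \<xi> Y) UNIV \<inter> hom_component q \<subseteq> insert \<xi> (multiples Y UNIV)"
    proof
      fix x assume x: "x \<in> multiples (insert \<xi> Y) UNIV \<inter> hom_component q"
      then obtain \<gamma> g where g: "g \<in> insert \<xi> Y" "x = mono_of \<gamma> *s g" by (auto simp: multiples_def)
      show "x \<in> insert \<xi> (multiples Y UNIV)"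
      proof (cases "g = \<xi>")
        case True
        have "x \<noteq> 0" "lead x = shift \<gamma> (lead \<xi>)" using lead_smult[OF \<xi>0] by (simp_all add: g(2) True)
        then have "deg_of \<gamma> + \<nu> = q"
          using wt_lead[of x q] x wt_lead[OF \<xi>(1) \<xi>0] by (simp add: wt_shift)
        then have "deg_of \<gamma> = 0" using q(1) by simp
        then have "\<gamma> = 0" by (simp only: deg_of_eq_0_iff)
        then show ?thesis by (simp add: g(2) True mono_of_0)
      next
        case False
        then show ?thesis using g by (auto simp: multiples_def)
      qed
    qed
    show ?thesis
      unfolding Y
    proof
      assume "u \<in> left_span (insert \<xi> Y)"
      then have "u \<in> L.span (multiples (insert \<xi> Y) UNIV \<inter> hom_component q)"
        unfolding left_span_eq by (rule span_hom_component[OF _ hom q(2)])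
      then have "u \<in> L.span (insert \<xi> (multiples Y UNIV))"
        using L.span_mono[OF sub] by (rule subsetD[rotated])
      moreover have "u \<notin> L.span (multiples Y UNIV)" using X(2) uX by (simp add: Y_def left_span_eq)
      \<comment> \<open>Steinitz exchange over K: u depends on \<xi> together with the multiples of
        Y, but not on the latter alone.\<close>
      ultimately have "\<xi> \<in> L.span (insert u (multiples Y UNIV))" by (rule L.in_span_insert)
      moreover have "insert u (multiples Y UNIV) \<subseteq> left_span X"
      proof -
        have "multiples Y UNIV \<subseteq> multiples X UNIV" by (rule multiples_mono) (auto simp: Y_def)
        then show ?thesis using left_span_base[OF uX] L.span_superset unfolding left_span_eq by (metis insert_subset subset_trans)
      qed
      ultimately have "\<xi> \<in> left_span X"
        using L.span_minimal[OF _ subspace_left_span, of "insert u (multiples Y UNIV)" X] by (metis subsetD)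
      then show False using \<xi>(2) by contradiction
    qed
  qed
qed

end

section \<open>The algorithm\<close>

context graded_free_module
begin

text \<open>\<open>S\<close> and \<open>W\<close> are all unprocessed pairs and inputs, including those already moved to the current pass.\<close>

definition alg_inv :: "('a ^ 's) set \<Rightarrow> nat \<Rightarrow> (nat \<times> nat) set \<Rightarrow> ('a ^ 's) set \<Rightarrow>
    ('a ^ 's) list \<Rightarrow> ('a ^ 's) set \<Rightarrow> bool" where
  "alg_inv U \<nu> S W gs Um \<longleftrightarrow>
     W \<subseteq> U \<and> Um \<subseteq> U \<and> U \<subseteq> W \<union> left_span (set gs) \<and> left_span (set gs) = left_span Um \<and>
     0 \<notin> set gs \<and> (\<forall>g\<in>set gs. \<exists>q\<le>\<nu>. g \<in> hom_component q) \<and> sorted (map deg_gr gs) \<and>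
     (\<forall>i j. (i, j) \<in> S \<longrightarrow> i < j \<and> j < length gs \<and> snd (lead (gs ! i)) = snd (lead (gs ! j))) \<and>
     (\<forall>i j. i < j \<and> j < length gs \<and> snd (lead (gs ! i)) = snd (lead (gs ! j)) \<longrightarrow>
        (i, j) \<in> S \<or> S_resolved (set gs) (gs ! i) (gs ! j)) \<and>
     (\<forall>u\<in>Um. \<exists>q\<le>\<nu>. u \<in> hom_component q) \<and> (\<forall>u\<in>Um. u \<notin> left_span (Um - {u}))"

lemma alg_inv_mono: "alg_inv U \<nu> S W gs Um \<Longrightarrow> \<nu> \<le> \<nu>' \<Longrightarrow> alg_inv U \<nu>' S W gs Um"
  unfolding alg_inv_def by (meson order_trans)

lemma alg_inv_finite:
  assumes "alg_inv U \<nu> S W gs Um" "finite U"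
  shows "finite S" "finite W"
proof -
  have "S \<subseteq> {..<length gs} \<times> {..<length gs}"
    using assms(1) unfolding alg_inv_def by fastforce
  then show "finite S" by (rule finite_subset) simp
  show "finite W" using assms finite_subset unfolding alg_inv_def by blast
qed

lemma alg_inv_homogeneous: "alg_inv U \<nu> S W gs Um \<Longrightarrow> \<forall>g\<in>set gs. homogeneous g"
  unfolding alg_inv_def homogeneous_def by blast

lemma alg_inv_nonzero: "alg_inv U \<nu> S W gs Um \<Longrightarrow> 0 \<notin> set gs"
  by (simp add: alg_inv_def)

lemma alg_inv_pair:
  assumes "alg_inv U \<nu> S W gs Um" "(i, j) \<in> S"
  shows "gs ! i \<noteq> 0" "gs ! j \<noteq> 0" "snd (lead (gs ! i)) = snd (lead (gs ! j))"
    "homogeneous (gs ! i)" "homogeneous (gs ! j)" "i < j" "j < length gs"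
proof -
  have ij: "i < j \<and> j < length gs \<and> snd (lead (gs ! i)) = snd (lead (gs ! j))"
    using assms unfolding alg_inv_def by blast
  then have "gs ! i \<in> set gs" "gs ! j \<in> set gs" by simp_all
  then show "gs ! i \<noteq> 0" "gs ! j \<noteq> 0" "homogeneous (gs ! i)" "homogeneous (gs ! j)"
    using alg_inv_nonzero[OF assms(1)] alg_inv_homogeneous[OF assms(1)] by metis+
  show "snd (lead (gs ! i)) = snd (lead (gs ! j))" "i < j" "j < length gs" using ij by blast+
qed

text \<open>Pairs are stored with increasing indices, so the opposite order needs the symmetry of
  S-polynomials. During a pass q is the current degree; once S is empty, q is arbitrary.\<close>

lemma alg_inv_resolved:
  assumes inv: "alg_inv U \<nu> S W gs Um" and deg: "\<forall>p\<in>S. q < pair_deg gs p"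
    and gh: "g \<in> set gs" "h \<in> set gs" "snd (lead g) = snd (lead h)" "S_deg g h \<le> q"
  shows "g = h \<or> S_resolved (set gs) g h"
proof -
  obtain i j where ij: "i < length gs" "g = gs ! i" "j < length gs" "h = gs ! j"
    using gh(1,2) by (auto simp: in_set_conv_nth)
  have res: "S_resolved (set gs) (gs ! k) (gs ! l)"
    if "k < l" "l < length gs" "snd (lead (gs ! k)) = snd (lead (gs ! l))" "S_deg (gs ! k) (gs ! l) \<le> q" for k l
  proof -
    have "(k, l) \<notin> S" using deg that(4) by (auto simp: pair_deg_def)
    then show ?thesis using inv that unfolding alg_inv_def by blast
  qed
  consider "i = j" | "i < j" | "j < i" by linarith
  then show ?thesis
  proof cases
    case 1
    then show ?thesis using ij by simp
  next
    case 2
    then show ?thesis using res[OF 2 ij(3)] gh(3,4) unfolding ij by simp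
  next
    case 3
    have "S_resolved (set gs) h g"
      using res[OF 3 ij(1)] gh(3,4) S_deg_commute[OF gh(3)] unfolding ij by simp
    then show ?thesis using S_resolved_commute[OF gh(3)] by simp
  qed
qed

lemma pair_deg_append: "fst p < length gs \<Longrightarrow> snd p < length gs \<Longrightarrow> pair_deg (gs @ [\<eta>]) p = pair_deg gs p"
  by (simp add: pair_deg_def nth_append)

lemma new_pairs_deg:
  assumes "\<eta> \<in> hom_component \<nu>" "\<eta> \<noteq> 0" "\<forall>g\<in>set gs. \<not> mono_dvd (lead g) (lead \<eta>)" "p \<in> new_pairs gs \<eta>"
  shows "\<nu> < pair_deg (gs @ [\<eta>]) p"
proof -
  obtain i where i: "p = (i, length gs)" "i < length gs" "snd (lead (gs ! i)) = snd (lead \<eta>)"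
    using assms(4) by (auto simp: new_pairs_def)
  have "\<not> mono_dvd (lead (gs ! i)) (lead \<eta>)" using assms(3) i(2) by simp
  then show ?thesis
    using S_deg_greater[OF assms(1,2) i(3)] i(2) by (simp add: i(1) pair_deg_def nth_append)
qed

text \<open>Shared by the two ways of enlarging the basis. What distinguishes them, namely which
  pairs and inputs are settled and whether a generator is selected, is left to the
  hypotheses.\<close>

lemma alg_inv_append:
  assumes inv: "alg_inv U \<nu> S W gs Um"
    and \<eta>: "\<eta> \<in> hom_component \<nu>" "\<eta> \<noteq> 0"
    and S': "S' \<subseteq> S" "\<And>i j. (i, j) \<in> S - S' \<Longrightarrow> S_resolved (insert \<eta> (set gs)) (gs ! i) (gs ! j)"
    and W': "W' \<subseteq> U" "U \<subseteq> W' \<union> left_span (insert \<eta> (set gs))"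
    and Um': "Um' \<subseteq> U" "left_span (insert \<eta> (set gs)) = left_span Um'"
      "\<forall>u\<in>Um'. \<exists>q\<le>\<nu>. u \<in> hom_component q" "\<forall>u\<in>Um'. u \<notin> left_span (Um' - {u})"
  shows "alg_inv U \<nu> (S' \<union> new_pairs gs \<eta>) W' (gs @ [\<eta>]) Um'"
proof -
  have set_eq: "set (gs @ [\<eta>]) = insert \<eta> (set gs)" by simp
  have gs: "0 \<notin> set gs" "\<forall>g\<in>set gs. \<exists>q\<le>\<nu>. g \<in> hom_component q" "sorted (map deg_gr gs)"
    using inv unfolding alg_inv_def by blast+
  have "deg_gr g \<le> \<nu>" if g: "g \<in> set gs" for g
  proof -
    obtain q where q: "q \<le> \<nu>" "g \<in> hom_component q" using gs(2) g by blast
    have "g \<noteq> 0" using g gs(1) by auto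
    then show ?thesis using hom_component_deg_gr[OF q(2)] q(1) by simp
  qed
  \<comment> \<open>Old elements have degree at most \<nu> and \<eta> has degree exactly
    \<nu>.\<close>
  then have sorted: "sorted (map deg_gr (gs @ [\<eta>]))"
    using gs(3) hom_component_deg_gr[OF \<eta>] by (simp add: sorted_append)
  have range: "i < j \<and> j < length gs \<and> snd (lead (gs ! i)) = snd (lead (gs ! j))" if "(i, j) \<in> S" for i j
    using inv that unfolding alg_inv_def by blast
  have pairs: "i < j \<and> j < length (gs @ [\<eta>]) \<and> snd (lead ((gs @ [\<eta>]) ! i)) = snd (lead ((gs @ [\<eta>]) ! j))"
    if "(i, j) \<in> S' \<union> new_pairs gs \<eta>" for i j
    using that
  proof
    assume "(i, j) \<in> S'"
    then have "(i, j) \<in> S" using S'(1) by blast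
    then show ?thesis using range[of i j] by (auto simp: nth_append)
  next
    assume "(i, j) \<in> new_pairs gs \<eta>"
    then show ?thesis by (auto simp: new_pairs_def nth_append)
  qed
  have resolved: "(i, j) \<in> S' \<union> new_pairs gs \<eta> \<or> S_resolved (set (gs @ [\<eta>])) ((gs @ [\<eta>]) ! i) ((gs @ [\<eta>]) ! j)"
    if ij: "i < j" "j < length (gs @ [\<eta>])" "snd (lead ((gs @ [\<eta>]) ! i)) = snd (lead ((gs @ [\<eta>]) ! j))" for i j
  proof (cases "j = length gs")
    case True
    then have "(i, j) \<in> new_pairs gs \<eta>" using ij by (auto simp: new_pairs_def nth_append)
    then show ?thesis by blast
  next
    case False
    then have j: "j < length gs" using ij(2) by simp
    then have eq: "(gs @ [\<eta>]) ! i = gs ! i" "(gs @ [\<eta>]) ! j = gs ! j" using ij(1) by (simp_all add: nth_append)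
    have "(i, j) \<in> S \<or> S_resolved (set gs) (gs ! i) (gs ! j)"
      using inv ij(1,3) j unfolding eq alg_inv_def by blast
    then show ?thesis
      unfolding eq set_eq using S'(2)[of i j] S_resolved_mono[OF subset_insertI, of "set gs" "gs ! i" "gs ! j" \<eta>] by blast
  qed
  have hom: "\<forall>g\<in>set (gs @ [\<eta>]). \<exists>q\<le>\<nu>. g \<in> hom_component q" using gs(2) \<eta>(1) by auto
  have nz: "0 \<notin> set (gs @ [\<eta>])" using gs(1) \<eta>(2) by auto
  show ?thesis
    unfolding alg_inv_def set_eq
    using W' Um' nz[unfolded set_eq] hom[unfolded set_eq] sorted pairs resolved[unfolded set_eq] by blast
qed

text \<open>Inside a pass \<nu> is its degree, and what waits for later passes lies strictly above.
  Between passes a weak bound is kept, so that the initial state can use \<nu> = 0 even when inputs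
  of degree 0 are pending.\<close>

primrec state_inv :: "('a ^ 's) set \<Rightarrow> ('a ^ 's) alg_state \<Rightarrow> bool" where
  "state_inv U (Pass_Start S W gs Um) \<longleftrightarrow>
     (\<exists>\<nu>. alg_inv U \<nu> S W gs Um \<and> (\<forall>p\<in>S. \<nu> \<le> pair_deg gs p) \<and> (\<forall>\<xi>\<in>W. \<nu> \<le> deg_gr \<xi>))"
| "state_inv U (In_Pass S W S\<nu> W\<nu> gs Um) \<longleftrightarrow>
     (\<exists>\<nu>. alg_inv U \<nu> (S \<union> S\<nu>) (W \<union> W\<nu>) gs Um \<and>
        (\<forall>p\<in>S. \<nu> < pair_deg gs p) \<and> (\<forall>\<xi>\<in>W. \<nu> < deg_gr \<xi>) \<and>
        (\<forall>p\<in>S\<nu>. pair_deg gs p = \<nu>) \<and> (\<forall>\<xi>\<in>W\<nu>. deg_gr \<xi> = \<nu>))"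
| "state_inv U (Returned gs Um) \<longleftrightarrow> (\<exists>\<nu>. alg_inv U \<nu> {} {} gs Um)"

lemma state_inv_init: "state_inv U (alg_init U)"
  using L.subspace_0[OF subspace_left_span]
  by (auto simp: alg_init_def alg_inv_def intro!: exI[of _ 0])

lemma state_inv_step:
  assumes U: "finite U" "\<forall>\<xi>\<in>U. \<xi> \<noteq> 0 \<and> homogeneous \<xi>"
    and "alg_step st st'" "state_inv U st"
  shows "state_inv U st'"
  using assms(3,4)
proof cases
  case (start_pass \<nu>\<^sub>0 gs S W S\<nu> W\<nu> Um)
  obtain \<nu> where \<nu>: "alg_inv U \<nu> S W gs Um" "\<forall>p\<in>S. \<nu> \<le> pair_deg gs p" "\<forall>\<xi>\<in>W. \<nu> \<le> deg_gr \<xi>"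
    using assms(4) by (auto simp: start_pass(1))
  have eq: "S - S\<nu> \<union> S\<nu> = S" "W - W\<nu> \<union> W\<nu> = W" using start_pass(4,5) by auto
  define D where "D = pair_deg gs ` S \<union> deg_gr ` W"
  have D: "finite D" using alg_inv_finite[OF \<nu>(1) U(1)] by (simp add: D_def)
  show ?thesis
  proof (cases "D = {}")
    \<comment> \<open>With nothing pending, as for an empty input, the value of \<open>Min\<close>
      carries no information; the old \<nu> still serves because all item sets are empty.\<close>
    case True
    then have "S = {}" "W = {}" by (auto simp: D_def)
    then show ?thesis
      unfolding start_pass(2) state_inv.simps eq using \<nu>(1) start_pass(4,5) by auto
  next
    case False
    have \<nu>\<^sub>0: "\<nu>\<^sub>0 = Min D" using start_pass(3) by (simp add: D_def)
    have "\<nu> \<le> \<nu>\<^sub>0" using Min_in[OF D False] \<nu>(2,3) unfolding \<nu>\<^sub>0 by (auto simp: D_def)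
    then have inv: "alg_inv U \<nu>\<^sub>0 S W gs Um" using alg_inv_mono[OF \<nu>(1)] by simp
    have "\<nu>\<^sub>0 \<le> d" if "d \<in> D" for d using Min_le[OF D that] by (simp add: \<nu>\<^sub>0)
    then have "\<forall>p\<in>S. \<nu>\<^sub>0 \<le> pair_deg gs p" "\<forall>\<xi>\<in>W. \<nu>\<^sub>0 \<le> deg_gr \<xi>" by (auto simp: D_def)
    then have "(\<forall>p\<in>S - S\<nu>. \<nu>\<^sub>0 < pair_deg gs p) \<and> (\<forall>\<xi>\<in>W - W\<nu>. \<nu>\<^sub>0 < deg_gr \<xi>)"
      by (auto simp: start_pass(4,5) order_less_le)
    then show ?thesis
      unfolding start_pass(2) state_inv.simps eq using inv by (intro exI[of _ \<nu>\<^sub>0]) (simp add: start_pass(4,5))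
  qed
next
  case (pair_zero i j S\<nu> gs S W W\<nu> Um)
  obtain \<nu> where \<nu>: "alg_inv U \<nu> (S \<union> S\<nu>) (W \<union> W\<nu>) gs Um" "\<forall>p\<in>S. \<nu> < pair_deg gs p"
    "\<forall>\<xi>\<in>W. \<nu> < deg_gr \<xi>" "\<forall>p\<in>S\<nu>. pair_deg gs p = \<nu>" "\<forall>\<xi>\<in>W\<nu>. deg_gr \<xi> = \<nu>"
    using assms(4) by (auto simp: pair_zero(1))
  note ij = alg_inv_pair[OF \<nu>(1) UnI2[OF pair_zero(3)]]
  have "S_resolved (set gs) (gs ! i) (gs ! j)"
    using S_resolved_zero[OF ij(1-3) alg_inv_nonzero[OF \<nu>(1)] pair_zero(4)] .
  then have "alg_inv U \<nu> (S \<union> (S\<nu> - {(i, j)})) (W \<union> W\<nu>) gs Um"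
    using \<nu>(1) unfolding alg_inv_def by blast
  then show ?thesis
    unfolding pair_zero(2) state_inv.simps using \<nu>(2-5) by (intro exI[of _ \<nu>]) simp
next
  case (pair_new i j S\<nu> gs \<eta> S W W\<nu> Um)
  obtain \<nu> where \<nu>: "alg_inv U \<nu> (S \<union> S\<nu>) (W \<union> W\<nu>) gs Um" "\<forall>p\<in>S. \<nu> < pair_deg gs p"
    "\<forall>\<xi>\<in>W. \<nu> < deg_gr \<xi>" "\<forall>p\<in>S\<nu>. pair_deg gs p = \<nu>" "\<forall>\<xi>\<in>W\<nu>. deg_gr \<xi> = \<nu>"
    using assms(4) by (auto simp: pair_new(1))
  note ij = alg_inv_pair[OF \<nu>(1) UnI2[OF pair_new(3)]]
  note gs = alg_inv_nonzero[OF \<nu>(1)] alg_inv_homogeneous[OF \<nu>(1)]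
  let ?S = "S_poly (gs ! i) (gs ! j)"
  have "S_deg (gs ! i) (gs ! j) = \<nu>" using \<nu>(4) pair_new(3) by (auto simp: pair_deg_def)
  then have "?S \<in> hom_component \<nu>" using S_poly_hom_component[OF ij(1-5)] by simp
  then have \<eta>: "\<eta> \<in> hom_component \<nu>" by (rule remainder_hom_component[OF pair_new(4) gs])
  have nd: "\<forall>g\<in>set gs. \<not> mono_dvd (lead g) (lead \<eta>)"
    using remainder_not_dvd[OF pair_new(4) gs(1) pair_new(5)] by blast
  have "?S \<in> left_span (set gs)"
  proof -
    have "gs ! i \<in> left_span (set gs)" "gs ! j \<in> left_span (set gs)"
      using ij(6,7) by (auto intro: left_span_base)
    then show ?thesis
      unfolding S_poly_def Let_def
      by (intro L.subspace_diff[OF subspace_left_span] L.subspace_scale[OF subspace_left_span] left_span_smult)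
  qed
  then have "?S - (?S - \<eta>) \<in> left_span (set gs)"
    by (rule L.subspace_diff[OF subspace_left_span _ remainder_left_span[OF pair_new(4) gs(1)]])
  then have ls: "left_span (insert \<eta> (set gs)) = left_span (set gs)"
    by (intro left_span_insert_absorb) simp
  have "alg_inv U \<nu> ((S \<union> (S\<nu> - {(i, j)})) \<union> new_pairs gs \<eta>) (W \<union> W\<nu>) (gs @ [\<eta>]) Um"
  proof (rule alg_inv_append[OF \<nu>(1) \<eta> pair_new(5)], unfold ls)
    show "S_resolved (insert \<eta> (set gs)) (gs ! i') (gs ! j')"
      if "(i', j') \<in> S \<union> S\<nu> - (S \<union> (S\<nu> - {(i, j)}))" for i' j'
    proof -
      have "i' = i" "j' = j" using that by auto
      then show ?thesis using S_resolved_insert[OF ij(1-3) gs(1) pair_new(4,5)] by simp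
    qed
  qed (use \<nu>(1) in \<open>auto simp: alg_inv_def\<close>)
  moreover have "pair_deg (gs @ [\<eta>]) p = pair_deg gs p" if "p \<in> S \<union> S\<nu>" for p
    using alg_inv_pair(6,7)[OF \<nu>(1), of "fst p" "snd p"] that by (intro pair_deg_append) auto
  moreover have "(S \<union> (S\<nu> - {(i, j)})) \<union> new_pairs gs \<eta> = (S \<union> new_pairs gs \<eta>) \<union> (S\<nu> - {(i, j)})"
    by blast
  moreover have "\<forall>p\<in>new_pairs gs \<eta>. \<nu> < pair_deg (gs @ [\<eta>]) p"
    using new_pairs_deg[OF \<eta> pair_new(5) nd] by blast
  ultimately show ?thesis
    unfolding pair_new(2) state_inv.simps using \<nu>(2-5) by (intro exI[of _ \<nu>]) auto
next
  case (input_zero \<xi> W\<nu> gs S W Um)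
  obtain \<nu> where \<nu>: "alg_inv U \<nu> S (W \<union> W\<nu>) gs Um" "\<forall>p\<in>S. \<nu> < pair_deg gs p"
    "\<forall>\<xi>\<in>W. \<nu> < deg_gr \<xi>" "\<forall>\<xi>\<in>W\<nu>. deg_gr \<xi> = \<nu>"
    using assms(4) by (auto simp: input_zero(1))
  have "\<xi> \<in> left_span (set gs)"
    using remainder_left_span[OF input_zero(4) alg_inv_nonzero[OF \<nu>(1)]] by simp
  then have "alg_inv U \<nu> S (W \<union> (W\<nu> - {\<xi>})) gs Um"
    using \<nu>(1) unfolding alg_inv_def by blast
  then show ?thesis
    unfolding input_zero(2) state_inv.simps using \<nu>(2-4) by (intro exI[of _ \<nu>]) simp
next
  case (input_new \<xi> W\<nu> gs \<eta> S W Um)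
  obtain \<nu> where \<nu>: "alg_inv U \<nu> S (W \<union> W\<nu>) gs Um" "\<forall>p\<in>S. \<nu> < pair_deg gs p"
    "\<forall>\<xi>\<in>W. \<nu> < deg_gr \<xi>" "\<forall>\<xi>\<in>W\<nu>. deg_gr \<xi> = \<nu>"
    using assms(4) by (auto simp: input_new(1))
  note gs = alg_inv_nonzero[OF \<nu>(1)] alg_inv_homogeneous[OF \<nu>(1)]
  have \<xi>U: "\<xi> \<in> U" using \<nu>(1) input_new(3) unfolding alg_inv_def by blast
  have \<xi>: "\<xi> \<in> hom_component \<nu>"
  proof -
    obtain q where q: "\<xi> \<in> hom_component q" using U(2) \<xi>U unfolding homogeneous_def by blast
    moreover have "q = \<nu>" using hom_component_deg_gr[OF q] U(2) \<xi>U \<nu>(4) input_new(3) by auto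
    ultimately show ?thesis by simp
  qed
  have \<eta>: "\<eta> \<in> hom_component \<nu>" by (rule remainder_hom_component[OF input_new(4) gs \<xi>])
  have nd: "\<forall>g\<in>set gs. \<not> mono_dvd (lead g) (lead \<eta>)"
    using remainder_not_dvd[OF input_new(4) gs(1) input_new(5)] by blast
  have diff: "\<xi> - \<eta> \<in> left_span (set gs)" by (rule remainder_left_span[OF input_new(4) gs(1)])
  have "\<eta> \<notin> left_span (set gs)"
  proof
    assume "\<eta> \<in> left_span (set gs)"
    \<comment> \<open>This rule requires the pairs of the current pass to be exhausted, so every
      pending pair has degree above \<nu> and the truncated criterion applies in degree
      \<nu>.\<close>
    then have "\<exists>g\<in>set gs. mono_dvd (lead g) (lead \<eta>)"
      using buchberger_truncated[OF gs alg_inv_resolved[OF \<nu>(1,2)]] \<eta> input_new(5) by blast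
    then show False using nd by blast
  qed
  then have \<xi>gs: "\<xi> \<notin> left_span (set gs)"
    using L.subspace_diff[OF subspace_left_span _ diff, of \<xi>] by auto
  have Um: "left_span (set gs) = left_span Um" using \<nu>(1) unfolding alg_inv_def by blast
  \<comment> \<open>Used below in both directions: modulo a common span, \<xi> and its remainder
    \<eta> can replace each other as generators.\<close>
  have span_insert: "left_span (insert x G) \<subseteq> left_span (insert y H)"
    if "x - y \<in> left_span H" "left_span G = left_span H" for x y G and H :: "('a ^ 's) set"
  proof (rule left_span_minimal, rule subsetI)
    fix z assume "z \<in> insert x G"
    then have "z = (x - y) + y \<or> z \<in> left_span H" using left_span_base that(2) by auto
    moreover have "left_span H \<subseteq> left_span (insert y H)" by (rule left_span_mono) auto
    moreover have "y \<in> left_span (insert y H)" by (rule left_span_base) simp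
    ultimately show "z \<in> left_span (insert y H)"
      using that(1) L.subspace_add[OF subspace_left_span, of "x - y" "insert y H" y] by auto
  qed
  have ls: "left_span (insert \<eta> (set gs)) = left_span (insert \<xi> Um)"
  proof (rule equalityI; rule span_insert)
    show "\<eta> - \<xi> \<in> left_span Um" using L.subspace_neg[OF subspace_left_span diff] by (simp add: Um)
    show "\<xi> - \<eta> \<in> left_span (set gs)" by (rule diff)
  qed (simp_all add: Um)
  have \<xi>in: "\<xi> \<in> left_span (insert \<eta> (set gs))" unfolding ls by (rule left_span_base) simp
  have sub: "left_span (set gs) \<subseteq> left_span (insert \<eta> (set gs))" by (rule left_span_mono) auto
  have old: "W \<union> W\<nu> \<subseteq> U" "Um \<subseteq> U" "U \<subseteq> (W \<union> W\<nu>) \<union> left_span (set gs)"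
    "\<forall>u\<in>Um. \<exists>q\<le>\<nu>. u \<in> hom_component q" "\<forall>u\<in>Um. u \<notin> left_span (Um - {u})"
    using \<nu>(1) unfolding alg_inv_def by blast+
  have "alg_inv U \<nu> (S \<union> new_pairs gs \<eta>) (W \<union> (W\<nu> - {\<xi>})) (gs @ [\<eta>]) (insert \<xi> Um)"
  proof (rule alg_inv_append[OF \<nu>(1) \<eta> input_new(5)])
    show "\<forall>u\<in>insert \<xi> Um. u \<notin> left_span (insert \<xi> Um - {u})"
      by (rule minimal_insert[OF old(4,5) \<xi>]) (use \<xi>gs Um in simp)
    show "U \<subseteq> W \<union> (W\<nu> - {\<xi>}) \<union> left_span (insert \<eta> (set gs))" using old(3) \<xi>in sub by blast
    show "\<forall>u\<in>insert \<xi> Um. \<exists>q\<le>\<nu>. u \<in> hom_component q" using old(4) \<xi> by blast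
  qed (use old \<xi>U ls in auto)
  moreover have "pair_deg (gs @ [\<eta>]) p = pair_deg gs p" if "p \<in> S" for p
    using alg_inv_pair(6,7)[OF \<nu>(1), of "fst p" "snd p"] that by (intro pair_deg_append) auto
  moreover have "\<forall>p\<in>new_pairs gs \<eta>. \<nu> < pair_deg (gs @ [\<eta>]) p"
    using new_pairs_deg[OF \<eta> input_new(5) nd] by blast
  ultimately show ?thesis
    unfolding input_new(2) state_inv.simps using \<nu>(2-4) by (intro exI[of _ \<nu>]) auto
next
  case (exit_loop S W gs Um)
  then show ?thesis using assms(4) by auto
next
  case (next_pass S W gs Um)
  obtain \<nu> where "alg_inv U \<nu> S W gs Um" "\<forall>p\<in>S. \<nu> < pair_deg gs p" "\<forall>\<xi>\<in>W. \<nu> < deg_gr \<xi>"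
    using assms(4) by (auto simp: next_pass(1))
  then show ?thesis
    unfolding next_pass(2) state_inv.simps by (intro exI[of _ \<nu>]) (simp add: less_imp_le)
qed

section \<open>Progress and termination\<close>

lemma state_inv_progress:
  assumes "state_inv U st" "\<nexists>st'. alg_step st st'"
  obtains gs Um where "st = Returned gs Um"
proof (cases st)
  case (Pass_Start S W gs Um)
  then show thesis using assms(2) alg_step.start_pass[OF refl refl refl] by blast
next
  case (In_Pass S W S\<nu> W\<nu> gs Um)
  then have gs: "0 \<notin> set gs" using assms(1) alg_inv_nonzero by auto
  have "\<exists>st'. alg_step st st'"
  proof (cases "S\<nu> = {}")
    case False
    then obtain i j where ij: "(i, j) \<in> S\<nu>" by auto
    obtain \<eta> where "is_remainder (set gs) (S_poly (gs ! i) (gs ! j)) \<eta>"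
      using remainder_exists[OF gs] by blast
    then show ?thesis
      unfolding In_Pass using alg_step.pair_zero[OF ij] alg_step.pair_new[OF ij] by (cases "\<eta> = 0") blast+
  next
    case Sempty: True
    show ?thesis
    proof (cases "W\<nu> = {}")
      case False
      then obtain \<xi> where \<xi>: "\<xi> \<in> W\<nu>" by auto
      obtain \<eta> where "is_remainder (set gs) \<xi> \<eta>"
        using remainder_exists[OF gs] by blast
      then show ?thesis
        unfolding In_Pass Sempty using alg_step.input_zero[OF \<xi>] alg_step.input_new[OF \<xi>] by (cases "\<eta> = 0") blast+
    next
      case True
      then show ?thesis
        unfolding In_Pass Sempty True using alg_step.exit_loop[of S W gs Um] alg_step.next_pass[of S W gs Um]
        by (cases "S = {} \<and> W = {}") (rule exI, simp)+
    qed
  qed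
  then show thesis using assms(2) by blast
qed (rule that)

text \<open>
  A pending item counts 3 while it waits and 1 in its pass, so that starting a pass decreases the
  count.  The value 3 for a start without pending items only concerns the empty input.
\<close>

primrec state_measure :: "('a ^ 's) alg_state \<Rightarrow> ('a ^ 's) list \<times> nat" where
  "state_measure (Pass_Start S W gs Um) = (gs, 3 * (card S + card W) + (if S = {} \<and> W = {} then 3 else 1))"
| "state_measure (In_Pass S W S\<nu> W\<nu> gs Um) = (gs, 3 * (card S + card W) + card S\<nu> + card W\<nu> + 2)"
| "state_measure (Returned gs Um) = (gs, 0)"

text \<open>The new leading monomial lies outside the monomial submodule generated by the old ones,
  so chains in this relation are strictly ascending chains of such submodules.\<close>

definition append_rel :: "(('a ^ 's) list \<times> ('a ^ 's) list) set" where
  "append_rel = {(gs @ [\<eta>], gs) |gs \<eta>. \<forall>g\<in>set gs. \<not> mono_dvd (lead g) (lead \<eta>)}"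

lemma wf_append_rel: "wf append_rel"
  unfolding append_rel_def
proof (rule wf_append_bad)
  fix f :: "nat \<Rightarrow> 'a ^ 's"
  show "\<exists>i j. i < j \<and> mono_dvd (lead (f i)) (lead (f j))"
    using dickson[of "\<lambda>i. lead (f i)"] by (simp add: mono_dvd_iff_le)
qed

text \<open>An append lowers the first component, however many pairs it creates; every other step
  keeps the list and lowers the count of pending work.\<close>

lemma state_measure_step:
  assumes U: "finite U" and "alg_step st st'" "state_inv U st"
  shows "(state_measure st', state_measure st) \<in> append_rel <*lex*> less_than"
  using assms(2)
proof cases
  case (start_pass \<nu> gs S W S\<nu> W\<nu> Um)
  obtain \<nu>\<^sub>1 where "alg_inv U \<nu>\<^sub>1 S W gs Um" using assms(3) by (auto simp: start_pass(1))
  from alg_inv_finite[OF this U] have fin: "finite S" "finite W" .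
  have sub: "S\<nu> \<subseteq> S" "W\<nu> \<subseteq> W" using start_pass(4,5) by auto
  then have card: "card (S - S\<nu>) + card S\<nu> = card S" "card (W - W\<nu>) + card W\<nu> = card W"
    using fin by (metis card_Diff_subset card_mono finite_subset le_add_diff_inverse2)+
  show ?thesis
  proof (cases "S = {} \<and> W = {}")
    case True
    then show ?thesis using sub by (simp add: start_pass(1,2))
  next
    case False
    then have "\<nu> \<in> pair_deg gs ` S \<union> deg_gr ` W"
      unfolding start_pass(3) using fin by (intro Min_in) auto
    then have "S\<nu> \<noteq> {} \<or> W\<nu> \<noteq> {}" by (auto simp: start_pass(4,5))
    \<comment> \<open>The minimum is attained, so some number k \<ge> 1 of items moves. Each drops
      from 3 to 1 while the constant rises from 1 to 2, a net decrease of 2 k - 1.\<close>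
    then have "card S\<nu> > 0 \<or> card W\<nu> > 0" using fin sub by (metis card_gt_0_iff finite_subset)
    then show ?thesis using card False by (simp add: start_pass(1,2)) linarith
  qed
next
  case (pair_zero i j S\<nu> gs S W W\<nu> Um)
  obtain \<nu> where "alg_inv U \<nu> (S \<union> S\<nu>) (W \<union> W\<nu>) gs Um" using assms(3) by (auto simp: pair_zero(1))
  from alg_inv_finite(1)[OF this U] have "finite S\<nu>" by simp
  then have "card (S\<nu> - {(i, j)}) < card S\<nu>" using pair_zero(3) by (rule card_Diff1_less)
  then show ?thesis by (simp add: pair_zero(1,2))
next
  case (pair_new i j S\<nu> gs \<eta> S W W\<nu> Um)
  then have "0 \<notin> set gs" using assms(3) alg_inv_nonzero by auto
  then show ?thesis
    using remainder_not_dvd[OF pair_new(4) _ pair_new(5)] by (auto simp: pair_new(1,2) append_rel_def)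
next
  case (input_zero \<xi> W\<nu> gs S W Um)
  obtain \<nu> where "alg_inv U \<nu> (S \<union> {}) (W \<union> W\<nu>) gs Um" using assms(3) by (auto simp: input_zero(1))
  from alg_inv_finite(2)[OF this U] have "finite W\<nu>" by simp
  then have "card (W\<nu> - {\<xi>}) < card W\<nu>" using input_zero(3) by (rule card_Diff1_less)
  then show ?thesis by (simp add: input_zero(1,2))
next
  case (input_new \<xi> W\<nu> gs \<eta> S W Um)
  then have "0 \<notin> set gs" using assms(3) alg_inv_nonzero by auto
  then show ?thesis
    using remainder_not_dvd[OF input_new(4) _ input_new(5)] by (auto simp: input_new(1,2) append_rel_def)
qed auto

text \<open>The measure is known to fall only where the invariant supplies finiteness of the pending
  sets and a basis without zero, so the invariant is carried through the induction.\<close>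

lemma alg_terminates:
  assumes U: "finite U" "\<forall>\<xi>\<in>U. \<xi> \<noteq> 0 \<and> homogeneous \<xi>"
  shows "state_inv U st \<Longrightarrow> termip alg_step st"
proof (induction st rule: wf_induct_rule[OF wf_inv_image[OF wf_lex_prod[OF wf_append_rel wf_less_than], of state_measure]])
  case (1 st)
  show ?case
  proof (rule accpI)
    fix st' assume "alg_step\<inverse>\<inverse> st' st"
    then have "alg_step st st'" by simp
    then have "(st', st) \<in> inv_image (append_rel <*lex*> less_than) state_measure"
      and "state_inv U st'"
      using state_inv_step[OF U _ 1(2)] state_measure_step[OF U(1) _ 1(2)] by simp_all
    then show "termip alg_step st'" by (rule 1(1))
  qed
qed

lemma alg_result:
  assumes inv: "alg_inv U \<nu> {} {} gs Um"
  shows "Um \<subseteq> U" "left_span Um = left_span U" "left_groebner_basis (set gs) (left_span U)"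
    "\<And>Y. Y \<subset> Um \<Longrightarrow> left_span Y \<noteq> left_span U" "\<forall>g\<in>set gs. homogeneous g" "sorted (map deg_gr gs)"
    "\<forall>u\<in>Um. homogeneous u"
proof -
  show Um: "Um \<subseteq> U" and "sorted (map deg_gr gs)" and "\<forall>u\<in>Um. homogeneous u"
    using inv unfolding alg_inv_def homogeneous_def by blast+
  note gs = alg_inv_nonzero[OF inv] alg_inv_homogeneous[OF inv]
  show "\<forall>g\<in>set gs. homogeneous g" by (rule gs(2))
  have "U \<subseteq> left_span (set gs)" and gsUm: "left_span (set gs) = left_span Um"
    using inv unfolding alg_inv_def by blast+
  then have "left_span U \<subseteq> left_span Um" using left_span_minimal by metis
  then show UmU: "left_span Um = left_span U" using left_span_mono[OF Um] by blast
  have "S_resolved (set gs) g h \<or> g = h"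
    if "g \<in> set gs" "h \<in> set gs" "snd (lead g) = snd (lead h)" for g h
    using alg_inv_resolved[OF inv _ that order_refl] by auto
  then have "\<exists>g\<in>set gs. mono_dvd (lead g) (lead f)" if "f \<in> left_span (set gs)" "f \<noteq> 0" for f
    using buchberger[OF gs _ that] by blast
  then show "left_groebner_basis (set gs) (left_span U)"
    using gs(1) left_span_base[of _ "set gs"] unfolding left_groebner_basis_def gsUm UmU by blast
  fix Y assume Y: "Y \<subset> Um"
  then obtain u where u: "u \<in> Um" "u \<notin> Y" by blast
  \<comment> \<open>Omitting a single element is the extreme case: a proper subset misses some u,
    which the remaining selected inputs do not generate.\<close>
  have "left_span Y \<subseteq> left_span (Um - {u})" by (rule left_span_mono) (use Y u in auto)
  moreover have "u \<notin> left_span (Um - {u})" using inv u(1) unfolding alg_inv_def by blast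
  moreover have "u \<in> left_span U" using left_span_base u(1) Um by blast
  ultimately show "left_span Y \<noteq> left_span U" by blast
qed

theorem alg_correct:
  assumes U: "finite U" "\<forall>\<xi>\<in>U. \<xi> \<noteq> 0 \<and> homogeneous \<xi>"
  shows "alg_returns U (\<lambda>gs Um. Um \<subseteq> U \<and> minimal_homogeneous_generating_set Um (left_span U) \<and>
    left_groebner_basis (set gs) (left_span U) \<and> (\<forall>g\<in>set gs. homogeneous g) \<and> sorted (map deg_gr gs))"
  unfolding alg_returns_def
proof (intro conjI allI impI)
  show "termip alg_step (alg_init U)" by (rule alg_terminates[OF U state_inv_init])
  fix st assume st: "alg_step\<^sup>*\<^sup>* (alg_init U) st \<and> \<not> (\<exists>st'. alg_step st st')"
  have "state_inv U st"
    using st[THEN conjunct1] by (induction rule: rtranclp_induct) (auto intro: state_inv_init state_inv_step[OF U])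
  moreover from this obtain gs Um where ret: "st = Returned gs Um"
    using state_inv_progress st by metis
  ultimately obtain \<nu> where "alg_inv U \<nu> {} {} gs Um" by auto
  note res = alg_result[OF this]
  show "\<exists>gs Um. st = Returned gs Um \<and> Um \<subseteq> U \<and> minimal_homogeneous_generating_set Um (left_span U) \<and>
    left_groebner_basis (set gs) (left_span U) \<and> (\<forall>g\<in>set gs. homogeneous g) \<and> sorted (map deg_gr gs)"
    unfolding minimal_homogeneous_generating_set_def using ret res by blast
qed

end

theorem theorem3p8:
  fixes scale :: "'k::field \<Rightarrow> 'a::ring_1 \<Rightarrow> 'a"
    and a :: "'n::{finite,linorder} \<Rightarrow> 'a"
    and prec :: "'n exponent \<Rightarrow> 'n exponent \<Rightarrow> bool"
    and m :: "'n \<Rightarrow> nat"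
    and b :: "'s::finite \<Rightarrow> nat"
    and precL :: "('n exponent) \<times> 's \<Rightarrow> ('n exponent) \<times> 's \<Rightarrow> bool"
    and \<xi>s :: "('a ^ 's) list"
  assumes "graded_free_module scale a prec m precL"
    and "\<And>\<xi>. \<xi> \<in> set \<xi>s \<Longrightarrow> \<xi> \<noteq> 0 \<and> graded_free_module.homogeneous scale a m b \<xi>"
    and "sorted (map (graded_free_module.deg_gr scale a m b) \<xi>s)"
  shows "graded_free_module.alg_returns scale a m b precL (set \<xi>s)
    (\<lambda>gs Umin.
       Umin \<subseteq> set \<xi>s \<and>
       graded_free_module.minimal_homogeneous_generating_set scale a m b Umin (left_span (set \<xi>s)) \<and>
       graded_free_module.left_groebner_basis scale a precL (set gs) (left_span (set \<xi>s)) \<and>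
       (\<forall>g\<in>set gs. graded_free_module.homogeneous scale a m b g) \<and>
       sorted (map (graded_free_module.deg_gr scale a m b) gs))"
proof -
  interpret graded_free_module scale a prec m b precL
    by (rule assms(1))
  show ?thesis
    by (rule alg_correct) (use assms(2) in simp_all)
qed

end
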